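(* The number of subsets $S\subseteq\{1,\dots,n\}$ such that every two distinct elements of $S$ are coprime equals $2^{\pi(n)}\cdot e^{(1+o(1))\sqrt n}$ as $n\to\infty$.
   Context: $\pi(n)$ denotes the number of primes at most $n$. *)

theory Defs
  imports Complex_Main "HOL-Computational_Algebra.Primes"
begin

definition prime_pi :: "nat \<Rightarrow> nat" where
  "prime_pi n = card {p::nat. prime p \<and> p \<le> n}"

definition coprime_subset_count :: "nat \<Rightarrow> nat" where
  "coprime_subset_count n =
     card {S. S \<subseteq> {1..n} \<and> (\<forall>a\<in>S. \<forall>b\<in>S. a \<noteq> b \<longrightarrow> coprime a b)}"

end

theory Submission
  imports Defs "HOL-Complex_Analysis.Complex_Analysis" "HOL-Number_Theory.Prime_Powers"
    "HOL-Real_Asymp.Real_Asymp"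
begin

text \<open>
  Every element of a pairwise coprime set \<open>S \<subseteq> {1..n}\<close> other than 1 is either prime or divisible by
  some prime \<open>q \<le> \<surd>n\<close>, and each such \<open>q\<close> divides at most one element of \<open>S\<close>. Hence the number
  of sets is at most \<open>2 ^ (\<pi>(n) + 1) \<cdot> (\<Prod>q \<le> \<surd>n. 1 + n div q)\<close>, whose excess over \<open>2 ^ \<pi>(n)\<close> has
  logarithm about \<open>\<pi>(\<surd>n) ln n - \<theta>(\<surd>n)\<close>. Conversely, the primes \<open>q \<le> d \<surd>n\<close> with \<open>d < 1\<close> can be
  matched injectively with primes \<open>p > \<surd>n\<close> such that \<open>p q \<le> n\<close>; processing the \<open>q\<close> in decreasing
  order always leaves a constant multiple of \<open>\<surd>n / ln n\<close> choices for \<open>p\<close>, and the unmatched primes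
  above \<open>\<surd>n\<close> may still be added freely. Both bounds are \<open>e ^ ((1 + o(1)) \<surd>n)\<close> precisely because
  of the prime number theorem \<open>\<pi>(x) ln x \<sim> x\<close>.

  The latter is derived along the lines of Newman and Zagier: \<open>\<Sum> (\<Lambda>(n) - 1) n ^ -s\<close>
  extends analytically to \<open>Re s \<ge> 1\<close>, so Newman's contour argument shows that
  \<open>\<Sum> (\<psi>(n) - n) / (n (n + 1))\<close> converges, which forces \<open>\<psi>(n) \<sim> n\<close> as \<open>\<psi>\<close> is monotone.
\<close>

section \<open>Newman's contour integral\<close>

text \<open>The exponent tolerates losses. There are about \<open>2 * sqrt n / ln n\<close> primes
  \<open>q \<le> sqrt n\<close>, so a constant or a power of \<open>ln n\<close> lost for each of
  them changes the logarithm of the count only by \<open>o(sqrt n)\<close>. Up to such factors most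
  of these \<open>q\<close> have size \<open>sqrt n\<close> and hence \<open>sqrt n\<close>
  multiples, and \<open>ln (sqrt n)\<close> times the number of such primes is \<open>sqrt n\<close>
  to first order. Chebyshev's bounds would fix the exponent only up to a constant factor.

  The obstacle in the lower bound is that distinct \<open>q\<close> must not share their large
  prime. As \<open>q + n / q \<ge> 2 * sqrt n\<close>, the interval from \<open>sqrt n\<close> to
  \<open>n / q\<close> is at least as long as the one from \<open>q\<close> to
  \<open>sqrt n\<close>, so \<open>q\<close> has choices beyond those taken by larger primes. This
  surplus degenerates as \<open>q\<close> approaches \<open>sqrt n\<close>, hence the cut at
  \<open>d * sqrt n\<close>; \<open>d\<close> tends to 1 only at the end.

  Newman's argument usually truncates a Laplace integral. Here Abel summation produces a series
  whose partial sums are already entire functions, so these take the place of the truncated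
  integrals.\<close>

lemma circle_kernel_eq:
  assumes "norm z = R" "R > 0"
  shows "(1 + z\<^sup>2 / (of_real R)\<^sup>2) / z = of_real (2 * Re z / R\<^sup>2)"
proof -
  have "(of_real R)\<^sup>2 = z * cnj z"
    using assms(1) complex_norm_square[of z] by simp
  moreover have "z \<noteq> 0" using assms by auto
  ultimately have "(1 + z\<^sup>2 / (of_real R)\<^sup>2) / z = (cnj z + z) / (of_real R)\<^sup>2"
    by (simp add: field_simps power2_eq_square)
  also have "cnj z + z = of_real (2 * Re z)"
    by (simp add: complex_eq_iff)
  finally show ?thesis by simp
qed

text \<open>Cauchy's formula on a circle, kept as two half circles because each half is later
  estimated by a different hypothesis. Subtracting \<open>e 0 / z\<close> leaves an entire function
  with integral 0 around the circle, and \<open>e 0 / z\<close> contributes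
  \<open>\<i> * e 0\<close> times the angle.\<close>

lemma half_circles_integral_over_z:
  assumes e: "e holomorphic_on UNIV" and R: "R > 0"
  obtains I1 I2 where
    "((\<lambda>z. e z / z) has_contour_integral I1) (part_circlepath 0 R (-(pi/2)) (pi/2))"
    "((\<lambda>z. e z / z) has_contour_integral I2) (part_circlepath 0 R (pi/2) (3*pi/2))"
    "I1 + I2 = 2 * of_real pi * \<i> * e 0"
proof -
  let ?P = "part_circlepath 0 R (-(pi/2)) (pi/2)" and ?Q = "part_circlepath 0 R (pi/2) (3*pi/2)"
  define F where "F = (\<lambda>z. if z = 0 then deriv e 0 else (e z - e 0) / (z - 0))"
  have F: "F holomorphic_on UNIV"
    unfolding F_def by (rule pole_lemma_open[OF e]) simp
  have Fi: "F contour_integrable_on part_circlepath 0 R s t" for s t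
    by (intro contour_integrable_continuous_part_circlepath holomorphic_on_imp_continuous_on
        holomorphic_on_subset[OF F]) simp
  define J1 where "J1 = contour_integral ?P F"
  define J2 where "J2 = contour_integral ?Q F"
  have J1: "(F has_contour_integral J1) ?P" and J2: "(F has_contour_integral J2) ?Q"
    using Fi by (simp_all add: J1_def J2_def has_contour_integral_integral)
  have exp_eq: "exp (\<i> * (complex_of_real pi * 3 / 2)) = exp (- (\<i> * complex_of_real pi / 2))"
  proof -
    have "exp (\<i> * (complex_of_real pi * 3 / 2)) = cis (3 * pi / 2)"
      by (simp add: cis_conv_exp mult_ac)
    also have "\<dots> = cis (-(pi/2)) * cis (2 * pi)" by (subst cis_mult) (simp add: field_simps)
    also have "\<dots> = cis (-(pi/2))" by simp
    also have "\<dots> = exp (- (\<i> * complex_of_real pi / 2))"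
      by (simp only: cis_conv_exp) (simp add: mult_ac)
    finally show ?thesis .
  qed
  have fin: "pathfinish ?P = pathstart ?Q" by simp
  have clo: "pathfinish (?P +++ ?Q) = pathstart (?P +++ ?Q)"
    using exp_eq by (simp add: mult_ac)
  have "(F has_contour_integral 0) (?P +++ ?Q)"
    by (rule Cauchy_theorem_convex_simple[OF F]) (use fin clo in \<open>auto intro!: valid_path_join\<close>)
  moreover have "(F has_contour_integral (J1 + J2)) (?P +++ ?Q)"
    by (intro has_contour_integral_join J1 J2) auto
  ultimately have J0: "J1 + J2 = 0"
    using has_contour_integral_unique by blast
  have inv: "((\<lambda>z. e 0 / z) has_contour_integral (of_real (t - s) * (e 0 * \<i>))) (part_circlepath 0 R s t)"
    if "s < t" for s t
  proof (subst has_contour_integral_part_circlepath_iff[OF that])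
    have "((\<lambda>x. e 0 * \<i>) has_integral (t - s) *\<^sub>R (e 0 * \<i>)) {s..t}"
      using has_integral_const_real[of "e 0 * \<i>" s t] that by simp
    thus "((\<lambda>x. e 0 / (0 + complex_of_real R * cis x) * complex_of_real R * \<i> * cis x) has_integral
        of_real (t - s) * (e 0 * \<i>)) {s..t}"
      using R by (simp add: scaleR_conv_of_real)
  qed
  have sum_eq: "((\<lambda>z. e z / z) has_contour_integral J + of_real (t - s) * (e 0 * \<i>)) (part_circlepath 0 R s t)"
    if "s < t" "(F has_contour_integral J) (part_circlepath 0 R s t)" for s t J
  proof (rule has_contour_integral_eq[OF has_contour_integral_add[OF that(2) inv[OF that(1)]]])
    fix z assume "z \<in> path_image (part_circlepath 0 R s t)"
    hence "z \<noteq> 0" using R in_path_image_part_circlepath[of z 0 R s t] that by auto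
    thus "F z + e 0 / z = e z / z" by (simp add: F_def field_simps)
  qed
  show ?thesis
    using that[OF sum_eq[OF _ J1] sum_eq[OF _ J2]] J0 by (simp add: algebra_simps)
qed

lemma times_exp_minus_le: "x * exp (- (l * x)) \<le> 1 / l" if "l > 0" for x l :: real
proof -
  have "l * x \<le> exp (l * x)" using exp_ge_add_one_self[of "l * x"] by linarith
  thus ?thesis using that by (simp add: exp_minus field_simps)
qed

text \<open>Here \<open>b\<close> is \<open>\<i> * R\<close> or its negative, a zero of the kernel
  factor. At parameter \<open>t\<close> of the segment that factor is \<open>O(t)\<close>, while the
  exponential has modulus \<open>exp (-(l * d * t))\<close>; the product is \<open>O(1 / l)\<close>
  uniformly, although the exponential alone does not decay near \<open>b\<close>.\<close>

lemma newman_segment_bound: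
  fixes b :: complex
  assumes W: "continuous_on (closed_segment b (of_real (-d))) W"
    and b: "b\<^sup>2 = -(of_real R)\<^sup>2" "Re b = 0" and R: "R > 0" and d: "d > 0"
  obtains K where "\<And>l z. l > 0 \<Longrightarrow> z \<in> closed_segment b (of_real (-d)) \<Longrightarrow>
      norm (W z * (exp (of_real l * z) * (1 + z\<^sup>2 / (of_real R)\<^sup>2))) \<le> K / l" "K \<ge> 0"
proof -
  have "compact (W ` closed_segment b (of_real (-d)))"
    by (intro compact_continuous_image W compact_segment)
  then obtain M where M: "\<And>z. z \<in> closed_segment b (of_real (-d)) \<Longrightarrow> norm (W z) \<le> M"
    by (meson bounded_iff compact_imp_bounded imageI)
  have M0: "M \<ge> 0" using M[of b] norm_ge_zero order_trans ends_in_segment(1) by metis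
  define K where "K = M * ((norm (of_real d + b) * (2 * norm b + norm (of_real d + b)) / R\<^sup>2) / d)"
  show ?thesis
  proof (rule that[of K])
    show "K \<ge> 0" using M0 d R by (simp add: K_def)
    fix l :: real and z assume l: "l > 0" and z: "z \<in> closed_segment b (of_real (-d))"
    then obtain t where t: "0 \<le> t" "t \<le> 1" "z = (1 - t) *\<^sub>R b + t *\<^sub>R of_real (-d)"
      by (auto simp: in_segment)
    have Rez: "Re z = - (t * d)" using t b by simp
    have zb: "z - b = - (of_real t * (of_real d + b))"
      using t(3) by (simp add: scaleR_conv_of_real algebra_simps)
    have n1: "norm (z - b) = t * norm (of_real d + b)"
      using t(1) by (simp add: zb norm_mult)
    have "norm (z + b) \<le> 2 * norm b + norm (z - b)"
      using norm_triangle_ineq[of "z - b" "2 * b"] by (simp add: norm_mult add.commute)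
    also have "norm (z - b) \<le> norm (of_real d + b)"
      unfolding n1 using t by (simp add: mult_left_le_one_le)
    finally have n2: "norm (z + b) \<le> 2 * norm b + norm (of_real d + b)" by simp
    have "1 + z\<^sup>2 / (of_real R)\<^sup>2 = (z - b) * (z + b) / (of_real R)\<^sup>2"
      using b(1) R by (simp add: field_simps power2_eq_square)
    hence "norm (1 + z\<^sup>2 / (of_real R)\<^sup>2) = norm (z - b) * norm (z + b) / R\<^sup>2"
      by (simp add: norm_mult norm_divide norm_power)
    also have "\<dots> \<le> t * norm (of_real d + b) * (2 * norm b + norm (of_real d + b)) / R\<^sup>2"
      using n2 t unfolding n1 by (intro divide_right_mono mult_left_mono) auto
    finally have n3: "norm (1 + z\<^sup>2 / (of_real R)\<^sup>2) \<le> t * (norm (of_real d + b) * (2 * norm b + norm (of_real d + b)) / R\<^sup>2)"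
      by (simp add: mult_ac)
    have "norm (exp (of_real l * z) * (1 + z\<^sup>2 / (of_real R)\<^sup>2)) \<le>
        exp (- (l * d * t)) * (t * (norm (of_real d + b) * (2 * norm b + norm (of_real d + b)) / R\<^sup>2))"
      unfolding norm_mult[of "exp _"] using n3 by (intro mult_mono) (auto simp: Rez mult_ac)
    also have "\<dots> = t * exp (- (l * d * t)) * (norm (of_real d + b) * (2 * norm b + norm (of_real d + b)) / R\<^sup>2)"
      by simp
    also have "\<dots> \<le> 1 / (l * d) * (norm (of_real d + b) * (2 * norm b + norm (of_real d + b)) / R\<^sup>2)"
      using l d by (intro mult_right_mono times_exp_minus_le) auto
    finally have n4: "norm (exp (of_real l * z) * (1 + z\<^sup>2 / (of_real R)\<^sup>2)) \<le> \<dots>" .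
    have "norm (W z * (exp (of_real l * z) * (1 + z\<^sup>2 / (of_real R)\<^sup>2))) \<le>
       M * (1 / (l * d) * (norm (of_real d + b) * (2 * norm b + norm (of_real d + b)) / R\<^sup>2))"
      unfolding norm_mult[of "W z"] using M[OF z] n4 M0 by (intro mult_mono) auto
    also have "\<dots> = K / l" by (simp add: K_def)
    finally show "norm (W z * (exp (of_real l * z) * (1 + z\<^sup>2 / (of_real R)\<^sup>2))) \<le> K / l" .
  qed
qed

text \<open>The half circle is deformed to the two segments joining \<open>\<i> * R\<close>,
  \<open>-d\<close> and \<open>-\<i> * R\<close>. By compactness \<open>U\<close> contains a uniform
  neighbourhood of the relevant part of the imaginary axis, which is what allows the step to the
  left of it.\<close>

lemma newman_left_contour:
  assumes W: "W holomorphic_on U" and U: "open U" "{z. 0 \<le> Re z} \<subseteq> U" and R: "R > 0"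
  obtains K where "\<And>l. l > 0 \<Longrightarrow> \<exists>T. norm T \<le> K / l \<and>
     ((\<lambda>z. W z * (exp (of_real l * z) * (1 + z\<^sup>2 / (of_real R)\<^sup>2))) has_contour_integral T)
       (part_circlepath 0 R (-(pi/2)) (pi/2))"
proof -
  define A where "A = closed_segment (-(\<i> * of_real (2*R))) (\<i> * of_real (2*R))"
  have A: "\<i> * of_real y \<in> A" if "\<bar>y\<bar> \<le> 2*R" for y
  proof -
    define t where "t = (y + 2*R) / (4*R)"
    have "0 \<le> t" "t \<le> 1" using that R by (auto simp: t_def field_simps)
    moreover have "\<i> * of_real y = (1 - t) *\<^sub>R (-(\<i> * of_real (2*R))) + t *\<^sub>R (\<i> * of_real (2*R))"
      using R by (auto simp: t_def complex_eq_iff field_simps)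
    ultimately show ?thesis unfolding A_def in_segment by blast
  qed
  have "A \<subseteq> {z. Re z = 0}" by (auto simp: A_def in_segment)
  hence "A \<subseteq> U" using U by force
  moreover have "compact A" by (simp add: A_def)
  ultimately obtain \<epsilon> where \<epsilon>: "\<epsilon> > 0" "(\<Union>x\<in>A. ball x \<epsilon>) \<subseteq> U"
    using compact_subset_open_imp_ball_epsilon_subset[OF _ U(1)] by blast
  define d where "d = \<epsilon> / 2"
  \<comment> \<open>A convex half-strip containing both the half circle and the two segments, so
    that Cauchy's theorem for convex sets suffices and \<open>U\<close> itself may have any
    shape.\<close>
  define S where "S = {z. Re z > -\<epsilon>} \<inter> ({z. Im z \<ge> -(2*R)} \<inter> {z. Im z \<le> 2*R})"
  have convS: "convex S"
    unfolding S_def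
    by (intro convex_Int convex_halfspace_Re_gt convex_halfspace_Im_ge convex_halfspace_Im_le)
  have SU: "S \<subseteq> U"
  proof
    fix z assume z: "z \<in> S"
    show "z \<in> U"
    proof (cases "Re z \<ge> 0")
      case False
      have "dist (\<i> * of_real (Im z)) z = \<bar>Re z\<bar>"
        by (simp add: dist_norm cmod_def)
      also have "\<dots> < \<epsilon>" using z False by (auto simp: S_def)
      finally have "z \<in> ball (\<i> * of_real (Im z)) \<epsilon>" by simp
      moreover have "\<i> * of_real (Im z) \<in> A" using z by (intro A) (auto simp: S_def)
      ultimately show ?thesis using \<epsilon> by blast
    qed (use U in auto)
  qed
  have d: "d > 0" "d < \<epsilon>" using \<epsilon> by (auto simp: d_def)
  have inS: "\<i> * of_real R \<in> S" "-(\<i> * of_real R) \<in> S" "of_real (-d) \<in> S"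
    using R d by (auto simp: S_def)
  have seg: "closed_segment (\<i> * of_real R) (of_real (-d)) \<subseteq> S"
            "closed_segment (-(\<i> * of_real R)) (of_real (-d)) \<subseteq> S"
    using inS convS closed_segment_subset by blast+
  have cont: "continuous_on B W" if "B \<subseteq> S" for B
    using holomorphic_on_imp_continuous_on holomorphic_on_subset[OF W] that SU by blast
  obtain K1 where K1: "\<And>l z. l > 0 \<Longrightarrow> z \<in> closed_segment (\<i> * of_real R) (of_real (-d)) \<Longrightarrow>
      norm (W z * (exp (of_real l * z) * (1 + z\<^sup>2 / (of_real R)\<^sup>2))) \<le> K1 / l" "K1 \<ge> 0"
    by (rule newman_segment_bound[OF cont[OF seg(1)], of R]) (use R d in \<open>auto simp: power_mult_distrib\<close>)
  obtain K2 where K2: "\<And>l z. l > 0 \<Longrightarrow> z \<in> closed_segment (-(\<i> * of_real R)) (of_real (-d)) \<Longrightarrow>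
      norm (W z * (exp (of_real l * z) * (1 + z\<^sup>2 / (of_real R)\<^sup>2))) \<le> K2 / l" "K2 \<ge> 0"
    by (rule newman_segment_bound[OF cont[OF seg(2)], of R]) (use R d in \<open>auto simp: power_mult_distrib\<close>)
  define D where "D = norm (of_real (-d) - \<i> * of_real R)"
  have D: "norm (-(\<i> * of_real R) - of_real (-d)) = D"
    unfolding D_def by (simp add: cmod_def)
  show ?thesis
  proof (rule that[of "(K1 + K2) * D"])
    fix l :: real assume l: "l > 0"
    let ?f = "\<lambda>z. W z * (exp (of_real l * z) * (1 + z\<^sup>2 / (of_real R)\<^sup>2))"
    let ?P = "part_circlepath 0 R (-(pi/2)) (pi/2)"
    let ?L1 = "linepath (\<i> * of_real R) (of_real (-d))"
    let ?L2 = "linepath (of_real (-d)) (-(\<i> * of_real R))"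
    have hol: "?f holomorphic_on S"
      by (intro holomorphic_intros holomorphic_on_subset[OF W SU]) (use R in auto)
    have PS: "path_image ?P \<subseteq> S"
    proof
      fix z assume "z \<in> path_image ?P"
      then obtain t where t: "t \<in> {-(pi/2)..pi/2}" "z = of_real R * exp (\<i> * of_real t)"
        by (auto simp: path_image_part_circlepath)
      have "Re z = R * cos t" "Im z = R * sin t" using t by (auto simp: Re_exp Im_exp)
      moreover have "cos t \<ge> 0" using t by (intro cos_ge_zero) auto
      moreover have "\<bar>R * sin t\<bar> \<le> R" using R by (simp add: abs_mult mult_left_le)
      hence "\<bar>R * sin t\<bar> \<le> 2*R" using R by linarith
      ultimately show "z \<in> S" using R \<epsilon> by (auto simp: S_def abs_le_iff intro: less_le_trans[of _ 0])
    qed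
    have ii: "?f contour_integrable_on ?P" "?f contour_integrable_on ?L1" "?f contour_integrable_on ?L2"
      using seg PS by (auto intro!: contour_integrable_continuous_part_circlepath
          contour_integrable_continuous_linepath
          continuous_on_subset[OF holomorphic_on_imp_continuous_on[OF hol]] simp: closed_segment_commute)
    define T where "T = contour_integral ?P ?f"
    define T1 where "T1 = contour_integral ?L1 ?f"
    define T2 where "T2 = contour_integral ?L2 ?f"
    have T: "(?f has_contour_integral T) ?P" "(?f has_contour_integral T1) ?L1" "(?f has_contour_integral T2) ?L2"
      using ii by (simp_all add: T_def T1_def T2_def has_contour_integral_integral)
    have ends: "exp (- (\<i> * complex_of_real pi / 2)) = -\<i>" "exp (\<i> * complex_of_real pi / 2) = \<i>"
      using cis_conv_exp[of "-(pi/2)"] cis_conv_exp[of "pi/2"] by (simp_all add: mult_ac)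
    have fin: "pathfinish ?P = \<i> * of_real R" "pathstart ?P = -(\<i> * of_real R)"
      using ends by (simp_all add: mult_ac)
    have "(?f has_contour_integral 0) (?P +++ (?L1 +++ ?L2))"
    proof (rule Cauchy_theorem_convex_simple[OF hol convS])
      show "valid_path (?P +++ (?L1 +++ ?L2))"
        using fin by (intro valid_path_join) auto
      show "path_image (?P +++ (?L1 +++ ?L2)) \<subseteq> S"
        using PS seg fin by (subst path_image_join) (auto simp: path_image_join closed_segment_commute)
    qed (use fin in auto)
    moreover have "(?f has_contour_integral (T + (T1 + T2))) (?P +++ (?L1 +++ ?L2))"
      using fin by (intro has_contour_integral_join T) (auto intro!: valid_path_join)
    ultimately have "T + (T1 + T2) = 0" using has_contour_integral_unique by blast
    hence "T = - (T1 + T2)" by (simp add: add_eq_0_iff2)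
    hence "norm T = norm (T1 + T2)" by (metis norm_minus_cancel)
    also have "\<dots> \<le> norm T1 + norm T2" by (rule norm_triangle_ineq)
    also have "norm T1 \<le> K1 / l * norm (of_real (-d) - \<i> * of_real R)"
      by (rule has_contour_integral_bound_linepath[OF T(2)]) (use K1 l in auto)
    also have "norm T2 \<le> K2 / l * norm (-(\<i> * of_real R) - of_real (-d))"
      by (rule has_contour_integral_bound_linepath[OF T(3)]) (use K2 l in \<open>auto simp: closed_segment_commute\<close>)
    finally have "norm T \<le> (K1 + K2) * D / l" unfolding D D_def[symmetric]
      by (simp add: algebra_simps add_divide_distrib)
    thus "\<exists>T. norm T \<le> (K1 + K2) * D / l \<and> (?f has_contour_integral T) ?P" using T by blast
  qed
qed

text \<open>\<open>h N 0 - g 0\<close> is recovered by integrating against the kernel \<open>exp (L z) (1 + z\<^sup>2 / R\<^sup>2) / z\<close>, which has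
  modulus \<open>2 \<bar>Re z\<bar> exp (L Re z) / R\<^sup>2\<close> on the circle and hence cancels the two hypotheses. The part
  \<open>(g z - g 0) / z\<close> is moved from the right half circle to a path inside \<open>U\<close> with \<open>Re z < 0\<close>.\<close>

lemma newman_contour_bound:
  fixes g :: "complex \<Rightarrow> complex"
  assumes g: "g holomorphic_on U" and U: "open U" "{z. 0 \<le> Re z} \<subseteq> U"
    and h: "\<And>N::nat. h N holomorphic_on UNIV"
    and C: "C \<ge> 0"
    and right: "\<And>N z. 0 < Re z \<Longrightarrow> norm (g z - h N z) * Re z \<le> C * exp (-(L N * Re z))"
    and left: "\<And>N z. Re z < 0 \<Longrightarrow> 1 < norm z \<Longrightarrow> norm (h N z) * (-Re z) \<le> C * exp (-(L N * Re z))"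
    and R: "R > 1"
  obtains K where "\<And>N. L N > 0 \<Longrightarrow> norm (h N 0 - g 0) \<le> 2 * C / R + K / L N"
proof -
  have R0: "R > 0" using R by simp
  define W where "W = (\<lambda>z. if z = 0 then deriv g 0 else (g z - g 0) / (z - 0))"
  have W: "W holomorphic_on U" unfolding W_def by (rule pole_lemma_open[OF g U(1)])
  obtain K where K: "\<And>l. l > 0 \<Longrightarrow> \<exists>T. norm T \<le> K / l \<and>
     ((\<lambda>z. W z * (exp (of_real l * z) * (1 + z\<^sup>2 / (of_real R)\<^sup>2))) has_contour_integral T)
       (part_circlepath 0 R (-(pi/2)) (pi/2))"
    using newman_left_contour[OF W U R0] by blast
  let ?P = "part_circlepath 0 R (-(pi/2)) (pi/2)" and ?Q = "part_circlepath 0 R (pi/2) (3*pi/2)"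
  have P: "norm z = R" "Re z \<ge> 0" if z: "z \<in> path_image ?P" for z
  proof -
    from z obtain t where t: "t \<in> {-(pi/2)..pi/2}" "z = of_real R * exp (\<i> * of_real t)"
      by (auto simp: path_image_part_circlepath)
    show "norm z = R" using t R0 by (simp add: norm_mult)
    have "cos t \<ge> 0" using t by (intro cos_ge_zero) auto
    thus "Re z \<ge> 0" using t R0 by (simp add: Re_exp)
  qed
  have Q: "norm z = R" "Re z \<le> 0" if z: "z \<in> path_image ?Q" for z
  proof -
    from z obtain t where t: "t \<in> {pi/2..3*pi/2}" "z = of_real R * exp (\<i> * of_real t)"
      by (auto simp: path_image_part_circlepath)
    show "norm z = R" using t R0 by (simp add: norm_mult)
    have "cos (t - pi) \<ge> 0" using t by (intro cos_ge_zero) (auto simp: field_simps)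
    hence "cos t \<le> 0" by simp
    thus "Re z \<le> 0" using t R0 by (simp add: Re_exp mult_nonneg_nonpos)
  qed
  have B0: "2 * C / R\<^sup>2 + norm (g 0) * (2 / (R\<^sup>2 * L N)) \<ge> 0" if "L N > 0" for N
    using that C by (intro add_nonneg_nonneg divide_nonneg_nonneg mult_nonneg_nonneg) auto
  have "norm (h N 0 - g 0) \<le> 2 * C / R + (norm (g 0) / R + K / (2*pi)) / L N" if l: "L N > 0" for N
  proof -
    define k :: "complex \<Rightarrow> complex" where "k = (\<lambda>z. exp (of_real (L N) * z) * (1 + z\<^sup>2 / (of_real R)\<^sup>2))"
    have k: "norm (k z / z) = exp (L N * Re z) * (2 * \<bar>Re z\<bar> / R\<^sup>2)" if "norm z = R" for z
      unfolding k_def times_divide_eq_right[symmetric] circle_kernel_eq[OF that R0]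
      by (simp add: norm_mult norm_divide norm_power)
    have "(\<lambda>z. (h N z - g 0) * k z) holomorphic_on UNIV"
      unfolding k_def by (intro holomorphic_intros h) (use R in auto)
    then obtain I1 I2 where I: 
      "((\<lambda>z. (h N z - g 0) * k z / z) has_contour_integral I1) ?P"
      "((\<lambda>z. (h N z - g 0) * k z / z) has_contour_integral I2) ?Q"
      "I1 + I2 = 2 * of_real pi * \<i> * ((h N 0 - g 0) * k 0)"
      by (rule half_circles_integral_over_z[OF _ R0])
    obtain T where T: "norm T \<le> K / L N" "((\<lambda>z. W z * k z) has_contour_integral T) ?P"
      using K[OF l] unfolding k_def by blast
    have "((\<lambda>z. (h N z - g z) * (k z / z)) has_contour_integral (I1 - T)) ?P"
    proof (rule has_contour_integral_eq[OF has_contour_integral_diff[OF I(1) T(2)]])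
      fix z assume "z \<in> path_image ?P"
      hence "z \<noteq> 0" using P R0 by fastforce
      thus "(h N z - g 0) * k z / z - W z * k z = (h N z - g z) * (k z / z)"
        by (simp add: W_def field_simps)
    qed
    hence "norm (I1 - T) \<le> 2 * C / R\<^sup>2 * R * (pi/2 - (-(pi/2)))"
    proof (rule has_contour_integral_bound_part_circlepath)
      fix z assume z: "z \<in> path_image ?P"
      show "norm ((h N z - g z) * (k z / z)) \<le> 2 * C / R\<^sup>2"
      \<comment> \<open>At the endpoints of the half circle the hypothesis \<open>right\<close> is
        silent, but the kernel vanishes there.\<close>
      proof (cases "Re z = 0")
        case False
        hence "Re z > 0" using P[OF z] by simp
        have "norm ((h N z - g z) * (k z / z)) = norm (g z - h N z) * Re z * exp (L N * Re z) * (2 / R\<^sup>2)"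
          using \<open>Re z > 0\<close> unfolding norm_mult[of _ "k z / z"] k[OF P(1)[OF z]] by (simp add: norm_minus_commute)
        also have "\<dots> \<le> C * exp (-(L N * Re z)) * exp (L N * Re z) * (2 / R\<^sup>2)"
          by (intro mult_right_mono right \<open>Re z > 0\<close>) auto
        also have "\<dots> = 2 * C / R\<^sup>2" by (simp add: exp_minus)
        finally show ?thesis .
      next
        case True
        hence "norm (k z / z) = 0" using k[OF P(1)[OF z]] by simp
        thus ?thesis using C by auto
      qed
    qed (use C R0 in auto)
    hence A1: "norm (I1 - T) \<le> 2 * C / R * pi" using R0 by (simp add: power2_eq_square)
    from I(2) have "norm I2 \<le> (2 * C / R\<^sup>2 + norm (g 0) * (2 / (R\<^sup>2 * L N))) * R * (3*pi/2 - pi/2)"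
    proof (rule has_contour_integral_bound_part_circlepath)
      fix z assume z: "z \<in> path_image ?Q"
      have nz: "norm z = R" using Q z by blast
      show "norm ((h N z - g 0) * k z / z) \<le> 2 * C / R\<^sup>2 + norm (g 0) * (2 / (R\<^sup>2 * L N))"
      proof (cases "Re z = 0")
        case False
        hence neg: "Re z < 0" using Q[OF z] by simp
        have "norm (h N z * (k z / z)) = norm (h N z) * (-Re z) * exp (L N * Re z) * (2 / R\<^sup>2)"
          using neg unfolding norm_mult[of _ "k z / z"] k[OF nz] by simp
        also have "\<dots> \<le> C * exp (-(L N * Re z)) * exp (L N * Re z) * (2 / R\<^sup>2)"
          using R nz by (intro mult_right_mono left neg) auto
        also have "\<dots> = 2 * C / R\<^sup>2" by (simp add: exp_minus)
        finally have 1: "norm (h N z * (k z / z)) \<le> 2 * C / R\<^sup>2" .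
        \<comment> \<open>The constant \<open>g 0\<close> does not grow with \<open>L N\<close>, so
          the decay of the exponential is left over and yields a factor
          \<open>1 / L N\<close>.\<close>
        have "norm (k z / z) = (-Re z) * exp (-(L N * (-Re z))) * (2 / R\<^sup>2)"
          using neg unfolding k[OF nz] by simp
        also have "\<dots> \<le> 1 / L N * (2 / R\<^sup>2)"
          by (intro mult_right_mono times_exp_minus_le l) auto
        finally have 2: "norm (g 0 * (k z / z)) \<le> norm (g 0) * (2 / (R\<^sup>2 * L N))"
          unfolding norm_mult[of "g 0"] by (intro mult_left_mono) (auto simp: mult_ac)
        have eq: "(h N z - g 0) * k z / z = h N z * (k z / z) - g 0 * (k z / z)"
          by (simp add: left_diff_distrib diff_divide_distrib)
        show ?thesis
          unfolding eq by (rule order.trans[OF norm_triangle_ineq4 add_mono[OF 1 2]])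
      next
        case True
        hence "norm (k z / z) = 0" using k[OF nz] by simp
        hence "norm ((h N z - g 0) * k z / z) = 0" by auto
        thus ?thesis using B0[OF l] by (simp only:)
      qed
    next
      show "pi / 2 \<le> 3 * pi / 2" by simp
    qed (fact B0[OF l] R0)+
    also have "\<dots> = (2 * C / R + norm (g 0) * 2 / (R * L N)) * pi"
      using R0 l by (simp add: field_simps power2_eq_square)
    finally have A2: "norm I2 \<le> \<dots>" .
    have "2 * pi * norm (h N 0 - g 0) = norm ((I1 - T) + T + I2)"
      using I(3) by (simp add: k_def norm_mult)
    also have "\<dots> \<le> norm (I1 - T) + norm T + norm I2"
      by (intro order.trans[OF norm_triangle_ineq] add_right_mono norm_triangle_ineq)
    also have "\<dots> \<le> 2 * C / R * pi + K / L N + (2 * C / R + norm (g 0) * 2 / (R * L N)) * pi"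
      using A1 A2 T by linarith
    also have "\<dots> = 2 * pi * (2 * C / R + (norm (g 0) / R + K / (2*pi)) / L N)"
      using R0 l by (simp add: field_simps)
    finally show ?thesis by simp
  qed
  thus ?thesis by (rule that)
qed

text \<open>The error splits into \<open>2 * C / R\<close>, uniform in \<open>N\<close>, and
  \<open>K / L N\<close> with \<open>K\<close> depending on \<open>R\<close>; so \<open>R\<close> is
  fixed first and \<open>N\<close> grows afterwards. The condition \<open>1 < norm z\<close> in
  \<open>left\<close> holds on circles of radius \<open>R > 1\<close> and in the application keeps
  \<open>z\<close> away from -1, where the estimate divides by \<open>z + 1\<close>.\<close>

theorem newman_contour:
  fixes g :: "complex \<Rightarrow> complex"
  assumes g: "g holomorphic_on U" and U: "open U" "{z. 0 \<le> Re z} \<subseteq> U"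
    and h: "\<And>N::nat. h N holomorphic_on UNIV"
    and L: "filterlim L at_top sequentially"
    and C: "C \<ge> 0"
    and right: "\<And>N z. 0 < Re z \<Longrightarrow> norm (g z - h N z) * Re z \<le> C * exp (-(L N * Re z))"
    and left: "\<And>N z. Re z < 0 \<Longrightarrow> 1 < norm z \<Longrightarrow> norm (h N z) * (-Re z) \<le> C * exp (-(L N * Re z))"
  shows "(\<lambda>N. h N 0) \<longlonglongrightarrow> g 0"
proof (rule metric_LIMSEQ_I)
  fix e :: real assume e: "e > 0"
  define R where "R = 4 * C / e + 2"
  have "4 * C / e \<ge> 0" using C e by simp
  hence R: "R > 1" unfolding R_def by linarith
  have "2 * C / R < e / 2"
  proof -
    have "4 * C < e * R" using e C by (simp add: R_def field_simps)
    thus ?thesis using R by (simp add: field_simps)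
  qed
  obtain K where K: "\<And>N. L N > 0 \<Longrightarrow> norm (h N 0 - g 0) \<le> 2 * C / R + K / L N"
    by (rule newman_contour_bound[where h = h and L = L, OF g U h C right left R]) blast+
  have "((\<lambda>N. K / L N) \<longlongrightarrow> 0) sequentially"
    using L by (intro real_tendsto_divide_at_top tendsto_const) auto
  hence "eventually (\<lambda>N. K / L N < e / 2) sequentially"
    using e by (intro order_tendstoD) auto
  moreover have "eventually (\<lambda>N. L N > 0) sequentially"
    using L by (simp add: filterlim_at_top_dense)
  ultimately have "eventually (\<lambda>N. dist (h N 0) (g 0) < e) sequentially"
  proof eventually_elim
    case (elim N)
    hence "norm (h N 0 - g 0) < e / 2 + e / 2"
      using K[of N] \<open>2 * C / R < e / 2\<close> by linarith
    thus ?case by (simp add: dist_norm)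
  qed
  thus "\<exists>no. \<forall>n\<ge>no. dist (h n 0) (g 0) < e" by (simp add: eventually_sequentially)
qed

section \<open>Newman's Tauberian theorem for Dirichlet series\<close>

text \<open>\<open>invpow t s\<close> is \<open>t ^ -s\<close> for \<open>t > 0\<close>; since \<open>ln 0 = 0\<close>, its value at \<open>t = 0\<close> is the junk value 1,
  so Dirichlet series are indexed by \<open>Suc n\<close>.\<close>

definition invpow :: "real \<Rightarrow> complex \<Rightarrow> complex" where
  "invpow t s = exp (-(s * of_real (ln t)))"

lemma norm_invpow: "norm (invpow t s) = exp (-(Re s * ln t))"
  by (simp add: invpow_def)

lemma invpow_1 [simp]: "invpow 1 s = 1"
  by (simp add: invpow_def)

lemma invpow_0_right [simp]: "invpow t 0 = 1"
  by (simp add: invpow_def)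

lemma invpow_1_right: "t > 0 \<Longrightarrow> invpow t 1 = of_real (1 / t)"
  by (simp add: invpow_def exp_minus exp_of_real field_simps)

lemma invpow_mult: "a > 0 \<Longrightarrow> b > 0 \<Longrightarrow> invpow (a * b) s = invpow a s * invpow b s"
  by (simp add: invpow_def ln_mult exp_add[symmetric] algebra_simps)

lemma invpow_add: "invpow t (s + s') = invpow t s * invpow t s'"
  by (simp add: invpow_def exp_add[symmetric] algebra_simps)

lemma invpow_has_field_derivative [derivative_intros]:
  "((\<lambda>s. invpow t s) has_field_derivative (- of_real (ln t) * invpow t s)) (at s within A)"
  unfolding invpow_def by (auto intro!: derivative_eq_intros)

lemma holomorphic_invpow [holomorphic_intros]:
  "f holomorphic_on A \<Longrightarrow> (\<lambda>s. invpow t (f s)) holomorphic_on A"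
  unfolding invpow_def by (intro holomorphic_intros)

lemma invpow_has_vector_derivative:
  assumes "t > 0"
  shows "((\<lambda>t. invpow t s) has_vector_derivative (- s * invpow t s / of_real t)) (at t)"
proof -
  have "((\<lambda>t. of_real (ln t)) has_vector_derivative of_real (1 / t)) (at t)"
    using DERIV_ln_divide[OF assms]
    by (simp add: has_real_derivative_iff_has_vector_derivative has_vector_derivative_of_real)
  moreover have "((\<lambda>w. exp (-(s * w))) has_field_derivative (- s * invpow t s)) (at (of_real (ln t)))"
    unfolding invpow_def by (auto intro!: derivative_eq_intros)
  ultimately have "((\<lambda>w. exp (-(s * w))) \<circ> (\<lambda>t. of_real (ln t)) has_vector_derivative (of_real (1 / t) * (- s * invpow t s))) (at t)"
    by (rule field_vector_diff_chain_at)
  thus ?thesis by (simp add: o_def invpow_def mult_ac)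
qed

text \<open>The fraction is \<open>\<integral> t ^ (-z - 2) dt\<close> over \<open>[n, n + 1]\<close>, and \<open>n \<le> t\<close> there.\<close>

lemma newman_term_bound:
  assumes n: "n \<ge> (1::real)" and z: "z \<noteq> -1" and x: "Re z \<noteq> 0"
  shows "n * norm ((invpow n (z+1) - invpow (n+1) (z+1)) / (z+1)) \<le>
           (exp (-(Re z * ln n)) - exp (-(Re z * ln (n+1)))) / Re z"
proof -
  define f where "f = (\<lambda>t. of_real n * (- invpow t (z+1) / (z+1)))"
  define f' where "f' = (\<lambda>t. of_real n * (invpow t (z+1) / of_real t))"
  \<comment> \<open>A primitive of \<open>t powr (-Re z - 1)\<close>, which dominates
    \<open>norm (f' t)\<close> because \<open>n \<le> t\<close>. Dividing by \<open>Re z\<close>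
    keeps it increasing for either sign of \<open>Re z\<close>.\<close>
  define \<phi> where "\<phi> = (\<lambda>t. - exp (-(Re z * ln t)) / Re z)"
  define \<phi>' where "\<phi>' = (\<lambda>t. exp (-(Re z * ln t)) / t)"
  have z1: "z + 1 \<noteq> 0" using z by (simp add: eq_neg_iff_add_eq_0)
  have df: "(f has_vector_derivative f' t) (at t)" if "t > 0" for t
  proof -
    have "((\<lambda>t. (- of_real n / (z+1)) * invpow t (z+1)) has_vector_derivative
        (- of_real n / (z+1)) * (- (z+1) * invpow t (z+1) / of_real t)) (at t)"
      by (intro has_vector_derivative_mult_right invpow_has_vector_derivative that)
    moreover have "(- of_real n / (z+1)) * (- (z+1) * invpow t (z+1) / of_real t) = f' t"
    proof -
      have "(- c / w) * (- w * y / u) = c * (y / u)" if "w \<noteq> 0" for c w y u :: complex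
        using that by simp
      thus ?thesis unfolding f'_def using z1 by blast
    qed
    ultimately show ?thesis by (simp add: f_def)
  qed
  have dp: "(\<phi> has_vector_derivative \<phi>' t) (at t)" if "t > 0" for t
    unfolding \<phi>_def \<phi>'_def has_real_derivative_iff_has_vector_derivative[symmetric]
    using that x by (auto intro!: derivative_eq_intros simp: field_simps)
  have "norm (f (n+1) - f n) \<le> \<phi> (n+1) - \<phi> n"
  proof (rule differentiable_bound_general)
    show "continuous_on {n..n+1} f" "continuous_on {n..n+1} \<phi>"
      using n by (auto intro!: continuous_at_imp_continuous_on has_vector_derivative_continuous df dp)
  next
    fix t assume t: "n < t" "t < n + 1"
    hence "t > 0" using n by simp
    have "norm (f' t) = n * exp (-(Re z * ln t)) / t\<^sup>2"
      using n \<open>t > 0\<close> by (simp add: f'_def norm_mult norm_divide norm_invpow ring_distribs exp_diff power2_eq_square)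
    also have "\<dots> \<le> t * exp (-(Re z * ln t)) / t\<^sup>2"
      using t by (intro divide_right_mono mult_right_mono) auto
    also have "\<dots> = \<phi>' t" using \<open>t > 0\<close> by (simp add: \<phi>'_def power2_eq_square)
    finally show "norm (f' t) \<le> \<phi>' t" .
  qed (use n df dp in auto)
  also have "f (n+1) - f n = of_real n * ((invpow n (z+1) - invpow (n+1) (z+1)) / (z+1))"
    by (simp add: f_def diff_divide_distrib right_diff_distrib)
  finally show ?thesis using n by (simp add: \<phi>_def norm_mult diff_divide_distrib)
qed

lemma abel_summation_invpow:
  "(\<Sum>n=1..M. (\<Sum>k=1..n. a k) * (invpow (real n) s - invpow (real n + 1) s)) =
   (\<Sum>n=1..M. a n * invpow (real n) s) - (\<Sum>k=1..M. a k) * invpow (real M + 1) s"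
  by (induction M) (simp_all add: algebra_simps)

text \<open>Abel summation turns the Dirichlet series into the expansion of \<open>G s / s\<close>
  in the terms \<open>A n * (invpow n s - invpow (n + 1) s) / s\<close>. The shift
  \<open>s = z + 1\<close> moves the boundary line to the imaginary axis, and at
  \<open>z = 0\<close> these terms are the summands of the conclusion. The linear bound on the
  partial sums provides the decay with \<open>L N = ln (N + 1)\<close>.\<close>

theorem newman_tauberian:
  fixes a :: "nat \<Rightarrow> complex"
  assumes bound: "\<And>n. norm (\<Sum>k=1..n. a k) \<le> C * real n"
    and sums: "\<And>s. Re s > 1 \<Longrightarrow> (\<lambda>n. a (Suc n) * invpow (real (Suc n)) s) sums G s"
    and G: "G holomorphic_on U" and U: "open U" "{s. Re s \<ge> 1} \<subseteq> U"
  shows "(\<lambda>n. (\<Sum>k=1..Suc n. a k) / of_real (real (Suc n) * (real (Suc n) + 1))) sums G 1"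
proof -
  define A where "A = (\<lambda>n. \<Sum>k=1..n. a k)"
  \<comment> \<open>The quotient \<open>(invpow n w - invpow (n + 1) w) / w\<close> with its
    removable singularity filled in: both powers are 1 at \<open>w = 0\<close>. The contour
    surrounds the corresponding point \<open>z = -1\<close>, so \<open>h N\<close> must be
    holomorphic there too.\<close>
  define E where "E = (\<lambda>n::nat. \<lambda>w. if w = 0 then deriv (\<lambda>w. invpow n w - invpow (real n + 1) w) 0
     else ((invpow n w - invpow (real n + 1) w) - (invpow n 0 - invpow (real n + 1) 0)) / (w - 0))"
  have E: "E n holomorphic_on UNIV" for n
    unfolding E_def by (rule pole_lemma_open) (auto intro!: holomorphic_intros)
  define h where "h = (\<lambda>N z. \<Sum>n=1..N. A n * E n (z + 1))"
  define g where "g = (\<lambda>z. G (z + 1) / (z + 1))"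
  \<comment> \<open>The condition \<open>Re z > -1\<close> keeps the denominator
    \<open>z + 1\<close> of \<open>g\<close> away from 0.\<close>
  define V where "V = (\<lambda>z. z + 1) -` U \<inter> {z. Re z > -1}"
  have C: "C \<ge> 0" using order.trans[OF norm_ge_zero bound[of 1]] by simp
  \<comment> \<open>One telescoping estimate serves both half planes: letting \<open>M\<close> tend
    to infinity bounds the tail for \<open>Re z > 0\<close>, and \<open>N = 0\<close> bounds the
    partial sum for \<open>Re z < 0\<close>.\<close>
  have diff_bound: "norm (h M z - h N z) \<le>
      C * ((exp (-(Re z * ln (real N + 1))) - exp (-(Re z * ln (real M + 1)))) / Re z)"
    if "z \<noteq> -1" "Re z \<noteq> 0" "N \<le> M" for M N z
    using \<open>N \<le> M\<close>
  proof (induction M rule: dec_induct)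
    case (step M)
    have "z + 1 \<noteq> 0" using that by (simp add: eq_neg_iff_add_eq_0)
    have "norm (A (Suc M) * E (Suc M) (z + 1)) \<le> C * real (Suc M) * norm (E (Suc M) (z + 1))"
      unfolding norm_mult A_def by (intro mult_right_mono bound) auto
    also have "\<dots> = C * (real (Suc M) * norm ((invpow (real (Suc M)) (z+1) - invpow (real (Suc M)+1) (z+1)) / (z+1)))"
      using \<open>z + 1 \<noteq> 0\<close> by (simp add: E_def mult_ac)
    also have "\<dots> \<le> C * ((exp (-(Re z * ln (real (Suc M)))) - exp (-(Re z * ln (real (Suc M)+1)))) / Re z)"
      using that C by (intro mult_left_mono newman_term_bound) auto
    finally have *: "norm (A (Suc M) * E (Suc M) (z + 1)) \<le> \<dots>" .
    have "h (Suc M) z - h N z = (h M z - h N z) + A (Suc M) * E (Suc M) (z + 1)"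
      by (simp add: h_def)
    hence "norm (h (Suc M) z - h N z) \<le> norm (h M z - h N z) + norm (A (Suc M) * E (Suc M) (z + 1))"
      by (simp only: norm_triangle_ineq)
    also have "\<dots> \<le> C * ((exp (-(Re z * ln (real N + 1))) - exp (-(Re z * ln (real M + 1)))) / Re z) +
       C * ((exp (-(Re z * ln (real (Suc M)))) - exp (-(Re z * ln (real (Suc M)+1)))) / Re z)"
      by (intro add_mono step.IH *)
    also have "\<dots> = C * ((exp (-(Re z * ln (real N + 1))) - exp (-(Re z * ln (real (Suc M) + 1)))) / Re z)"
      by (simp add: diff_divide_distrib algebra_simps)
    finally show ?case .
  qed simp
  have lim: "(\<lambda>M. h M z) \<longlonglongrightarrow> g z" if z: "Re z > 0" for z
  proof -
    have z1: "z + 1 \<noteq> 0" using z by (auto simp: complex_eq_iff)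
    have "(\<lambda>M. \<Sum>n<M. a (Suc n) * invpow (real (Suc n)) (z+1)) \<longlonglongrightarrow> G (z + 1)"
      using sums[of "z+1"] z unfolding sums_def by simp
    moreover have "(\<Sum>n<M. a (Suc n) * invpow (real (Suc n)) (z+1)) = (\<Sum>n=1..M. a n * invpow (real n) (z+1))" for M
      by (induction M) auto
    ultimately have 1: "(\<lambda>M. \<Sum>n=1..M. a n * invpow (real n) (z+1)) \<longlonglongrightarrow> G (z + 1)" by simp
    have 2: "(\<lambda>M. A M * invpow (real M + 1) (z + 1)) \<longlonglongrightarrow> 0"
    proof (rule Lim_null_comparison)
      show "\<forall>\<^sub>F M in sequentially. norm (A M * invpow (real M + 1) (z + 1)) \<le> C * exp (-(Re z * ln (real M + 1)))"
      proof (intro always_eventually allI)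
        fix M
        have "norm (A M * invpow (real M + 1) (z + 1)) \<le> (C * real M) * exp (-((Re z + 1) * ln (real M + 1)))"
          unfolding norm_mult norm_invpow using bound[of M] by (intro mult_mono) (auto simp: A_def C)
        also have "\<dots> \<le> (C * (real M + 1)) * exp (-((Re z + 1) * ln (real M + 1)))"
          using C by (intro mult_right_mono mult_left_mono) auto
        also have "\<dots> = C * exp (-(Re z * ln (real M + 1)))"
        proof -
          have "exp (-((Re z + 1) * ln (real M + 1))) = exp (-(Re z * ln (real M + 1))) / (real M + 1)"
            by (simp add: ring_distribs exp_diff)
          thus ?thesis by simp
        qed
        finally show "norm (A M * invpow (real M + 1) (z + 1)) \<le> C * exp (-(Re z * ln (real M + 1)))" .
      qed
      have "filterlim (\<lambda>M. Re z * ln (real M + 1)) at_top sequentially"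
        using z by (intro filterlim_tendsto_pos_mult_at_top[OF tendsto_const] 
            filterlim_compose[OF ln_at_top] filterlim_tendsto_add_at_top[OF tendsto_const] 
            filterlim_real_sequentially, simp_all add: add.commute)
             (intro filterlim_tendsto_add_at_top[OF tendsto_const] filterlim_real_sequentially)
      hence "(\<lambda>M. exp (-(Re z * ln (real M + 1)))) \<longlonglongrightarrow> 0"
        by (intro filterlim_compose[OF exp_at_bot] filterlim_compose[OF filterlim_uminus_at_bot_at_top])
      from tendsto_mult_left[OF this, of C] show "(\<lambda>M. C * exp (-(Re z * ln (real M + 1)))) \<longlonglongrightarrow> 0" by simp
    qed
    have "h M z = ((\<Sum>n=1..M. a n * invpow (real n) (z+1)) - A M * invpow (real M + 1) (z + 1)) / (z + 1)" for M
      unfolding A_def abel_summation_invpow[symmetric] h_def sum_divide_distrib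
      using z1 by (simp add: E_def)
    moreover have "(\<lambda>M. ((\<Sum>n=1..M. a n * invpow (real n) (z+1)) - A M * invpow (real M + 1) (z + 1)) / (z + 1)) \<longlonglongrightarrow> (G (z + 1) - 0) / (z + 1)"
      by (intro tendsto_intros 1 2 z1)
    ultimately show ?thesis by (simp add: g_def)
  qed
  have "(\<lambda>N. h N 0) \<longlonglongrightarrow> g 0"
  proof (rule newman_contour[where U = V and C = C and L = "\<lambda>N. ln (real N + 1)"])
    show "g holomorphic_on V"
      unfolding g_def V_def
      by (intro holomorphic_intros holomorphic_on_compose_gen[OF _ G, unfolded o_def])
         (auto simp: complex_eq_iff)
    show "open V" unfolding V_def
      by (intro open_Int open_halfspace_Re_gt open_vimage U continuous_intros)
    show "{z. 0 \<le> Re z} \<subseteq> V" by (auto simp: V_def intro!: subsetD[OF U(2)])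
    show "h N holomorphic_on UNIV" for N
      unfolding h_def
      by (intro holomorphic_intros holomorphic_on_compose_gen[OF _ E, unfolded o_def]) auto
    show "filterlim (\<lambda>N. ln (real N + 1)) at_top sequentially"
      by (intro filterlim_compose[OF ln_at_top])
         (subst add.commute, intro filterlim_tendsto_add_at_top[OF tendsto_const] filterlim_real_sequentially)
  next
    fix N z assume z: "Re z > 0"
    hence z1: "z \<noteq> -1" by (auto simp: complex_eq_iff)
    have "norm (g z - h N z) \<le> C * (exp (-(Re z * ln (real N + 1))) / Re z)"
    proof (rule tendsto_upperbound)
      show "(\<lambda>M. norm (h M z - h N z)) \<longlonglongrightarrow> norm (g z - h N z)"
        by (intro tendsto_intros lim z)
      show "\<forall>\<^sub>F M in sequentially. norm (h M z - h N z) \<le> C * (exp (-(Re z * ln (real N + 1))) / Re z)"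
        using eventually_ge_at_top[of N]
      proof eventually_elim
        case (elim M)
        have "norm (h M z - h N z) \<le> C * ((exp (-(Re z * ln (real N + 1))) - exp (-(Re z * ln (real M + 1)))) / Re z)"
          using z z1 elim by (intro diff_bound) auto
        also have "\<dots> \<le> C * (exp (-(Re z * ln (real N + 1))) / Re z)"
          using z C by (intro mult_left_mono divide_right_mono) auto
        finally show ?case .
      qed
    qed simp
    thus "norm (g z - h N z) * Re z \<le> C * exp (-(ln (real N + 1) * Re z))"
      using z by (simp add: field_simps)
  next
    fix N and z :: complex assume z: "Re z < 0" "1 < norm z"
    hence z1: "z \<noteq> -1" by auto
    have "norm (h N z) = norm (h N z - h 0 z)" by (simp add: h_def)
    also have "\<dots> \<le> C * ((exp (-(Re z * ln (real 0 + 1))) - exp (-(Re z * ln (real N + 1)))) / Re z)"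
      using z z1 by (intro diff_bound) auto
    also have "\<dots> = C * ((exp (-(Re z * ln (real N + 1))) - 1) / (-Re z))"
      using z by (simp add: field_simps)
    also have "\<dots> \<le> C * (exp (-(Re z * ln (real N + 1))) / (-Re z))"
      using z C by (intro mult_left_mono divide_right_mono) auto
    finally show "norm (h N z) * (-Re z) \<le> C * exp (-(ln (real N + 1) * Re z))"
      using z by (simp add: field_simps)
  qed (rule C)
  moreover have "h N 0 = (\<Sum>n<N. (\<Sum>k=1..Suc n. a k) / of_real (real (Suc n) * (real (Suc n) + 1)))" for N
  proof -
    have "h N 0 = (\<Sum>n<N. A (Suc n) * E (Suc n) 1)"
      unfolding h_def by (induction N) auto
    also have "\<dots> = (\<Sum>n<N. (\<Sum>k=1..Suc n. a k) / of_real (real (Suc n) * (real (Suc n) + 1)))"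
    proof (rule sum.cong)
      fix n
      have "E (Suc n) 1 = of_real (1 / real (Suc n) - 1 / (real (Suc n) + 1))"
        unfolding E_def by (simp add: invpow_1_right)
      also have "1 / real (Suc n) - 1 / (real (Suc n) + 1) = 1 / (real (Suc n) * (real (Suc n) + 1))"
        by (simp add: field_simps)
      finally show "A (Suc n) * E (Suc n) 1 = (\<Sum>k=1..Suc n. a k) / of_real (real (Suc n) * (real (Suc n) + 1))"
        by (simp add: A_def)
    qed simp
    finally show ?thesis .
  qed
  ultimately show ?thesis by (simp add: sums_def g_def)
qed

section \<open>Chebyshev's function\<close>

definition psi :: "nat \<Rightarrow> real" where
  "psi n = (\<Sum>k=1..n. mangoldt k)"

lemma psi_mono: "m \<le> n \<Longrightarrow> psi m \<le> psi n"
  unfolding psi_def by (intro sum_mono2) (auto simp: mangoldt_nonneg)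

text \<open>Legendre's formula in logarithmic form: each \<open>ln k\<close> is a divisor sum of
  \<open>mangoldt\<close>, and exchanging the sums counts the multiples of \<open>d\<close>.\<close>

lemma ln_fact_eq_sum_mangoldt:
  "ln (fact n) = (\<Sum>d=1..n. mangoldt d * real (n div d))"
proof -
  have "ln (fact n) = (\<Sum>k=1..n. ln (real k))"
    by (induction n) (auto simp: ln_mult fact_nonzero of_nat_Suc[symmetric] simp del: of_nat_Suc)
  also have "\<dots> = (\<Sum>k=1..n. \<Sum>d\<in>{d\<in>{1..n}. d dvd k}. mangoldt d)"
  proof (rule sum.cong)
    fix k assume k: "k \<in> {1..n}"
    have "{d. d dvd k} = {d\<in>{1..n}. d dvd k}"
      using k by (auto simp: Suc_le_eq dvd_pos_nat dest: dvd_imp_le)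
    thus "ln (real k) = (\<Sum>d\<in>{d\<in>{1..n}. d dvd k}. mangoldt d)"
      using mangoldt_sum[of k, where 'a=real] k by simp
  qed simp
  also have "\<dots> = (\<Sum>d=1..n. \<Sum>k\<in>{k\<in>{1..n}. d dvd k}. mangoldt d)"
    by (rule sum.swap_restrict) auto
  also have "\<dots> = (\<Sum>d=1..n. mangoldt d * real (n div d))"
  proof (rule sum.cong)
    fix d assume d: "d \<in> {1..n}"
    have "{k\<in>{1..n}. d dvd k} = (\<lambda>j. d * j) ` {1..n div d}"
      using d by (auto simp: dvd_def image_iff less_eq_div_iff_mult_less_eq mult_ac Suc_le_eq)
    moreover have "inj_on (\<lambda>j. d * j) {1..n div d}" using d by (auto simp: inj_on_def)
    ultimately have "card {k\<in>{1..n}. d dvd k} = n div d" by (simp add: card_image)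
    thus "(\<Sum>k\<in>{k\<in>{1..n}. d dvd k}. mangoldt d) = mangoldt d * real (n div d)" by simp
  qed simp
  finally show ?thesis .
qed

text \<open>Chebyshev's argument: in the logarithm of the central binomial coefficient,
  \<open>mangoldt d\<close> has weight \<open>(2*n) div d - 2 * (n div d)\<close>. This is never
  negative and is at least 1 for \<open>n < d \<le> 2*n\<close>.\<close>

lemma psi_double_le: "psi (2*n) - psi n \<le> 2 * real n * ln 2"
proof -
  have "psi (2*n) - psi n = (\<Sum>d\<in>{n<..2*n}. mangoldt d)"
  proof -
    have "{1..2*n} = {1..n} \<union> {n<..2*n}" by auto
    hence "psi (2*n) = psi n + (\<Sum>d\<in>{n<..2*n}. mangoldt d)"
      unfolding psi_def by (simp only:) (rule sum.union_disjoint, auto)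
    thus ?thesis by simp
  qed
  also have "\<dots> \<le> (\<Sum>d\<in>{n<..2*n}. mangoldt d * (real ((2*n) div d) - 2 * real (n div d)))"
  proof (rule sum_mono)
    fix d assume "d \<in> {n<..2*n}"
    hence "n div d = 0" "(2*n) div d \<ge> 1" by (auto simp: Suc_le_eq div_greater_zero_iff)
    hence "1 \<le> real ((2*n) div d) - 2 * real (n div d)" by simp
    thus "mangoldt d \<le> mangoldt d * (real ((2*n) div d) - 2 * real (n div d))"
      using mult_left_mono[OF _ mangoldt_nonneg[of d], of 1] by simp
  qed
  also have "\<dots> \<le> (\<Sum>d=1..2*n. mangoldt d * (real ((2*n) div d) - 2 * real (n div d)))"
  proof (rule sum_mono2)
    fix d
    have "2 * (n div d) \<le> (2*n) div d"
      using div_mult1_eq[of 2 n d] by simp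
    thus "0 \<le> mangoldt d * (real ((2*n) div d) - 2 * real (n div d))"
      by (intro mult_nonneg_nonneg mangoldt_nonneg) linarith
  qed auto
  also have "\<dots> = ln (fact (2*n)) - 2 * (\<Sum>d=1..2*n. mangoldt d * real (n div d))"
    unfolding ln_fact_eq_sum_mangoldt by (simp add: algebra_simps sum_subtractf sum_distrib_left)
  also have "(\<Sum>d=1..2*n. mangoldt d * real (n div d)) = (\<Sum>d=1..n. mangoldt d * real (n div d))"
    by (rule sum.mono_neutral_right) auto
  also have "\<dots> = ln (fact n)" by (simp add: ln_fact_eq_sum_mangoldt)
  also have "ln (fact (2*n)) - 2 * ln (fact n :: real) = ln (real ((2*n) choose n))"
  proof -
    have "real ((2*n) choose n) = fact (2*n) / (fact n * fact n)"
      using binomial_fact[of n "2*n", where 'a=real] by (simp add: mult_2)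
    thus ?thesis by (simp add: ln_div ln_mult)
  qed
  also have "\<dots> \<le> ln (real (2 ^ (2*n)))"
    using binomial_le_pow2[of "2*n" n] by (subst ln_le_cancel_iff) (auto simp del: of_nat_power)
  also have "\<dots> = 2 * real n * ln 2" by (simp add: ln_realpow)
  finally show ?thesis .
qed

text \<open>Summing the doubling bound over powers of two gives the factor \<open>2 * ln 2\<close>;
  rounding \<open>n\<close> up to a power of two costs another factor 2.\<close>

lemma psi_le: "psi n \<le> 4 * ln 2 * real n"
proof (cases "n = 0")
  case False
  have pow: "psi (2^k) \<le> 2 * 2^k * ln 2" for k
  proof (induction k)
    case 0 thus ?case by (simp add: psi_def)
  next
    case (Suc k)
    thus ?case using psi_double_le[of "2^k"] by simp
  qed
  obtain k where k: "2^k \<le> n" "n < 2^(Suc k)"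
    using ex_power_ivl1[of 2 n] False by auto
  have "psi n \<le> psi (2^Suc k)" using k by (intro psi_mono) simp
  also have "\<dots> \<le> 4 * 2^k * ln 2" using pow[of "Suc k"] by simp
  also have "\<dots> \<le> 4 * real n * ln 2"
    using of_nat_mono[OF k(1), where 'a=real] by (intro mult_right_mono) auto
  finally show ?thesis by (simp add: mult_ac)
qed (simp add: psi_def)

text \<open>If \<open>psi N\<close> exceeds \<open>(1 + e) * N\<close>, monotonicity keeps
  \<open>psi n - n\<close> above \<open>e * N / 2\<close> on a block of length about
  \<open>e * N / 2\<close> to the right of \<open>N\<close>; if it is too small, the same happens to
  the left. Such a block contributes a fixed positive amount, against the Cauchy criterion.\<close>

lemma psi_asymp_from_summable:
  assumes "summable (\<lambda>n. (psi n - real n) / (real n * real (n+1)))"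
  shows "(\<lambda>n. psi n / real n) \<longlonglongrightarrow> 1"
proof (rule metric_LIMSEQ_I)
  fix e' :: real assume e': "e' > 0"
  define e where "e = min e' 1"
  have e: "e > 0" "e \<le> 1" "e \<le> e'" using e' by (auto simp: e_def)
  define t where "t = (\<lambda>n. (psi n - real n) / (real n * real (n+1)))"
  have "e\<^sup>2/24 > 0" using e by simp
  \<comment> \<open>The threshold is the size of a block sum: at least \<open>e * N / 2\<close>
    terms, each at least \<open>(e * N / 2) / (6 * N * N)\<close>, where the 6 comes from
    \<open>n \<le> 2 * N\<close> and \<open>n + 1 \<le> 3 * N\<close>.\<close>
  then obtain M where M: "\<And>m n. m \<ge> M \<Longrightarrow> norm (sum t {m..<n}) < e\<^sup>2 / 24"
    using assms unfolding summable_Cauchy t_def by blast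
  show "\<exists>no. \<forall>n\<ge>no. dist (psi n / real n) 1 < e'"
  proof (intro exI allI impI)
    fix N assume N: "N \<ge> 2 * M + 1"
    \<comment> \<open>The blocks have \<open>j + 1\<close> elements, which makes up for rounding
      down. Since \<open>e \<le> 1\<close>, \<open>j\<close> is at most \<open>N / 2\<close>, so the
      left block still starts at or beyond \<open>M\<close>.\<close>
    define j where "j = nat \<lfloor>e * real N / 2\<rfloor>"
    have N1: "N \<ge> 1" using N by simp
    have j0: "e * N / 2 \<ge> 0" using e by simp
    have j: "real j \<le> e * N / 2" "e * N / 2 < real j + 1"
      using j0 unfolding j_def by linarith+
    have jN: "real j \<le> N / 2" using j(1) mult_right_mono[OF e(2), of "real N"] by simp
    have jN': "2 * j \<le> N" using jN by linarith
    have upper: "psi N < (1 + e) * N"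
    proof (rule ccontr)
      assume "\<not> psi N < (1 + e) * N"
      hence big: "psi N \<ge> (1 + e) * N" by simp
      have "e\<^sup>2 / 24 \<le> (e * N / 2) * (e * N / 2 / (6 * N * N))"
        using N1 by (simp add: field_simps power2_eq_square)
      also have "\<dots> \<le> real (card {N..<N+j+1}) * (e * N / 2 / (6 * N * N))"
        using j e by (intro mult_right_mono) auto
      also have "\<dots> \<le> sum t {N..<N+j+1}"
      proof (rule sum_bounded_below)
        fix n assume n: "n \<in> {N..<N+j+1}"
        have "psi n \<ge> psi N" using n by (intro psi_mono) auto
        moreover have "real n \<le> N + j" using n by auto
        ultimately have 1: "psi n - n \<ge> e * N / 2" using big j by (simp add: algebra_simps)
        have "real n \<le> 2 * real N" "real (n+1) \<le> 3 * real N"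
          using n jN' N1 by auto
        hence "real n * real (n+1) \<le> (2 * real N) * (3 * real N)" by (intro mult_mono) auto
        hence 2: "real n * real (n+1) \<le> 6 * N * N" by simp
        show "e * N / 2 / (6 * N * N) \<le> t n"
          unfolding t_def by (rule frac_le) (use 1 2 n N1 j0 in \<open>auto intro: order.trans[OF j0]\<close>)
      qed
      also have "\<dots> < e\<^sup>2 / 24"
        using M[of N "N+j+1"] N by (auto simp del: sum.op_ivl_Suc intro: le_less_trans[OF abs_ge_self])
      finally show False by simp
    qed
    have lower: "psi N > (1 - e) * N"
    proof (rule ccontr)
      assume "\<not> psi N > (1 - e) * N"
      hence small: "psi N \<le> (1 - e) * N" by simp
      have "e\<^sup>2 / 24 \<le> (e * N / 2) * (e * N / 2 / (6 * N * N))"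
        using N1 by (simp add: field_simps power2_eq_square)
      also have "\<dots> \<le> real (card {N-j..<N+1}) * (e * N / 2 / (6 * N * N))"
        using j e jN' by (intro mult_right_mono) auto
      also have "\<dots> \<le> sum (\<lambda>n. - t n) {N-j..<N+1}"
      proof (rule sum_bounded_below)
        fix n assume n: "n \<in> {N-j..<N+1}"
        have n0: "n > 0" using n jN' N1 by auto
        have "psi n \<le> psi N" using n by (intro psi_mono) auto
        moreover have "real n \<ge> real N - j" using n by auto
        ultimately have 1: "n - psi n \<ge> e * N / 2" using small j by (simp add: algebra_simps)
        have "real n \<le> 2 * real N" "real (n+1) \<le> 3 * real N"
          using n jN' N1 by auto
        hence "real n * real (n+1) \<le> (2 * real N) * (3 * real N)" by (intro mult_mono) auto
        hence 2: "real n * real (n+1) \<le> 6 * N * N" by simp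
        have "e * N / 2 / (6 * N * N) \<le> (n - psi n) / (real n * real (n+1))"
          by (rule frac_le) (use 1 2 n n0 N1 j0 in \<open>auto intro: order.trans[OF j0]\<close>)
        also have "\<dots> = - t n" unfolding t_def by (simp add: minus_divide_left)
        finally show "e * N / 2 / (6 * N * N) \<le> - t n" .
      qed
      also have "\<dots> < e\<^sup>2 / 24"
        using M[of "N-j" "N+1"] N jN' unfolding sum_negf real_norm_def by linarith
      finally show False by simp
    qed
    have "dist (psi N / N) 1 < e"
      using upper lower N1 by (simp add: dist_real_def abs_less_iff field_simps)
    thus "dist (psi N / N) 1 < e'" using e by simp
  qed
qed

section \<open>Dirichlet series\<close>

lemma norm_invpow_powr: "t > 0 \<Longrightarrow> norm (invpow t s) = t powr (- Re s)"
  by (simp add: norm_invpow powr_def)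

text \<open>A common majorant for the coefficients 1 of zeta and \<open>mangoldt n\<close>, which is
  at most \<open>ln n\<close>. It works because \<open>ln\<close> grows more slowly than any
  positive power.\<close>

lemma summable_ln_powr:
  fixes x :: real
  assumes "x > 1"
  shows "summable (\<lambda>n. (ln (real (Suc n)) + 1) * real (Suc n) powr (-x))"
proof -
  \<comment> \<open>Half of the margin \<open>x - 1\<close>: the exponent \<open>a - x\<close> is
    still below -1.\<close>
  define a where "a = (x - 1) / 2"
  have a: "a > 0" "a - x < -1" using assms by (auto simp: a_def field_simps)
  have "summable (\<lambda>n. (1 / a + 1) * real (Suc n) powr (a - x))"
    by (intro summable_mult) (subst summable_Suc_iff[of "\<lambda>n. real n powr (a - x)"], use a in \<open>simp add: summable_real_powr_iff\<close>)
  thus ?thesis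
  proof (rule summable_comparison_test')
    fix n
    have n: "real (Suc n) \<ge> 1" by simp
    have "ln (real (Suc n)) \<le> real (Suc n) powr a / a" by (rule ln_powr_bound[OF n a(1)])
    moreover have "1 \<le> real (Suc n) powr a" using n a by (intro ge_one_powr_ge_zero) auto
    ultimately have "ln (real (Suc n)) + 1 \<le> (1 / a + 1) * real (Suc n) powr a" by (simp add: algebra_simps)
    moreover have "ln (real (Suc n)) \<ge> 0" using n by (intro ln_ge_zero)
    ultimately have "(ln (real (Suc n)) + 1) * real (Suc n) powr (-x) \<le> ((1 / a + 1) * real (Suc n) powr a) * real (Suc n) powr (-x)"
      by (intro mult_right_mono) auto
    also have "\<dots> = (1 / a + 1) * real (Suc n) powr (a - x)"
      by (simp add: powr_diff powr_minus divide_inverse mult_ac)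
    finally show "norm ((ln (real (Suc n)) + 1) * real (Suc n) powr (-x)) \<le> (1 / a + 1) * real (Suc n) powr (a - x)"
      using \<open>ln (real (Suc n)) \<ge> 0\<close> by simp
  qed
qed

lemma dirichlet_series_abs_summable:
  assumes "\<And>n. norm (c n) \<le> ln (real (Suc n)) + 1" "Re s > 1"
  shows "summable (\<lambda>n. norm (c n * invpow (real (Suc n)) s))"
  by (rule summable_comparison_test'[OF summable_ln_powr[OF assms(2)]])
     (use assms(1) in \<open>auto simp: norm_mult norm_invpow_powr intro!: mult_right_mono\<close>)

lemma dirichlet_series_derivative:
  assumes c: "\<And>n. norm (c n) \<le> ln (real (Suc n)) + 1" and s: "Re s > 1"
  shows "((\<lambda>s. \<Sum>n. c n * invpow (real (Suc n)) s) has_field_derivative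
            (\<Sum>n. c n * (- of_real (ln (real (Suc n))) * invpow (real (Suc n)) s))) (at s)"
proof -
  define f where "f = (\<lambda>n s. c n * invpow (real (Suc n)) s)"
  define f' where "f' = (\<lambda>n s. c n * (- of_real (ln (real (Suc n))) * invpow (real (Suc n)) s))"
  have op: "open {s. Re s > 1}" by (rule open_halfspace_Re_gt)
  have "\<exists>g g'. \<forall>s\<in>{s. Re s > 1}. (\<lambda>n. f n s) sums g s \<and> (\<lambda>n. f' n s) sums g' s \<and> (g has_field_derivative g' s) (at s)"
  proof (rule series_and_derivative_comparison_complex[OF op])
    show "(f n has_field_derivative f' n x) (at x)" for n x
      unfolding f_def f'_def by (intro DERIV_cmult invpow_has_field_derivative)
  next
    fix x :: complex assume "x \<in> {s. Re s > 1}"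
    hence x: "Re x > 1" by simp
    \<comment> \<open>The midpoint between 1 and \<open>Re x\<close>; on the ball of radius
      \<open>Re x - b\<close> every real part is at least \<open>b\<close>, so one majorant serves
      the whole ball.\<close>
    define b where "b = (1 + Re x) / 2"
    have b: "b > 1" using x by (simp add: b_def)
    define hh where "hh = (\<lambda>n. of_real ((ln (real (Suc n)) + 1) * real (Suc n) powr (-b)) :: complex)"
    have "norm (f n y) \<le> norm (hh n)" if y: "y \<in> ball x (Re x - b)" for n y
    proof -
      have "Re x - Re y \<le> norm (x - y)" using complex_Re_le_cmod[of "x - y"] by simp
      hence "Re y \<ge> b" using y by (simp add: dist_norm)
      hence "real (Suc n) powr (- Re y) \<le> real (Suc n) powr (-b)" by (intro powr_mono) auto
      hence "norm (f n y) \<le> (ln (real (Suc n)) + 1) * real (Suc n) powr (-b)"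
        unfolding f_def norm_mult using c[of n] by (subst norm_invpow_powr) (auto intro!: mult_mono)
      thus ?thesis unfolding hh_def norm_of_real by (rule order.trans[OF _ abs_ge_self])
    qed
    moreover have "Re x - b > 0" using x by (simp add: b_def field_simps)
    moreover have "summable hh" unfolding hh_def by (intro summable_of_real summable_ln_powr b)
    moreover have "range hh \<subseteq> \<real>\<^sub>\<ge>\<^sub>0" by (auto simp: hh_def)
    ultimately show "\<exists>d h. 0 < d \<and> summable h \<and> range h \<subseteq> \<real>\<^sub>\<ge>\<^sub>0 \<and>
        (\<forall>\<^sub>F n in sequentially. \<forall>y\<in>ball x d \<inter> {s. Re s > 1}. cmod (f n y) \<le> cmod (h n))"
      by (intro exI[of _ "Re x - b"] exI[of _ hh]) auto
  qed
  then obtain g g' where g: "\<And>s. Re s > 1 \<Longrightarrow> (\<lambda>n. f n s) sums g s"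
    "\<And>s. Re s > 1 \<Longrightarrow> (\<lambda>n. f' n s) sums g' s" 
    "\<And>s. Re s > 1 \<Longrightarrow> (g has_field_derivative g' s) (at s)" by auto
  have "((\<lambda>s. \<Sum>n. f n s) has_field_derivative g' s) (at s)"
    by (rule has_field_derivative_transform_within_open[OF g(3)[OF s] op]) (use s g(1) in \<open>auto simp: sums_iff\<close>)
  moreover have "g' s = (\<Sum>n. f' n s)" using g(2)[OF s] by (simp add: sums_iff)
  ultimately show ?thesis by (simp only: f_def f'_def)
qed

section \<open>The zeta and von Mangoldt series for \<open>Re s > 1\<close>\<close>

definition zeta_series :: "complex \<Rightarrow> complex" where
  "zeta_series s = (\<Sum>n. invpow (real (Suc n)) s)"

definition mangoldt_series :: "complex \<Rightarrow> complex" where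
  "mangoldt_series s = (\<Sum>n. mangoldt (Suc n) * invpow (real (Suc n)) s)"

lemma norm_mangoldt_Suc_le: "norm (mangoldt (Suc n) :: complex) \<le> ln (real (Suc n)) + 1"
  using mangoldt_le[of "Suc n"] by simp

text \<open>Unordered summation over the positive integers, the form in which the double series of a
  product can be regrouped by divisors.\<close>

lemma zeta_series_has_sum:
  assumes "Re s > 1"
  shows "((\<lambda>n. invpow (real n) s) has_sum zeta_series s) {0<..}"
    and "(\<lambda>n. norm (invpow (real n) s)) summable_on {0<..}"
proof -
  have bij: "bij_betw Suc UNIV {0<..}" by (rule bij_betwI[of _ _ _ "\<lambda>n. n - 1"]) auto
  have 1: "summable (\<lambda>n. norm (invpow (real (Suc n)) s))"
    using dirichlet_series_abs_summable[of "\<lambda>_. 1" s] assms by simp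
  hence "((\<lambda>n. invpow (real (Suc n)) s) has_sum zeta_series s) UNIV"
    unfolding zeta_series_def
    by (intro norm_summable_imp_has_sum summable_sums summable_norm_cancel[of "\<lambda>n. invpow (real (Suc n)) s"])
  thus "((\<lambda>n. invpow (real n) s) has_sum zeta_series s) {0<..}"
    using has_sum_reindex_bij_betw[OF bij, of "\<lambda>n. invpow (real n) s"] by blast
  have "(\<lambda>n. norm (invpow (real (Suc n)) s)) summable_on UNIV"
    using 1 by (intro norm_summable_imp_summable_on) simp
  thus "(\<lambda>n. norm (invpow (real n) s)) summable_on {0<..}"
    using summable_on_reindex_bij_betw[OF bij, of "\<lambda>n. norm (invpow (real n) s)"] by blast
qed

lemma mangoldt_series_has_sum:
  assumes "Re s > 1"
  shows "((\<lambda>n. mangoldt n * invpow (real n) s) has_sum mangoldt_series s) {0<..}"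
    and "(\<lambda>n. norm (mangoldt n * invpow (real n) s)) summable_on {0<..}"
proof -
  have bij: "bij_betw Suc UNIV {0<..}" by (rule bij_betwI[of _ _ _ "\<lambda>n. n - 1"]) auto
  have 1: "summable (\<lambda>n. norm (mangoldt (Suc n) * invpow (real (Suc n)) s))"
    by (intro dirichlet_series_abs_summable norm_mangoldt_Suc_le assms)
  hence "((\<lambda>n. mangoldt (Suc n) * invpow (real (Suc n)) s) has_sum mangoldt_series s) UNIV"
    unfolding mangoldt_series_def
    by (intro norm_summable_imp_has_sum summable_sums summable_norm_cancel[of "\<lambda>n. mangoldt (Suc n) * invpow (real (Suc n)) s"])
  thus "((\<lambda>n. mangoldt n * invpow (real n) s) has_sum mangoldt_series s) {0<..}"
    using has_sum_reindex_bij_betw[OF bij, of "\<lambda>n. mangoldt n * invpow (real n) s"] by blast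
  have "(\<lambda>n. norm (mangoldt (Suc n) * invpow (real (Suc n)) s)) summable_on UNIV"
    using 1 by (intro norm_summable_imp_summable_on) simp
  thus "(\<lambda>n. norm (mangoldt n * invpow (real n) s)) summable_on {0<..}"
    using summable_on_reindex_bij_betw[OF bij, of "\<lambda>n. norm (mangoldt n * invpow (real n) s)"] by blast
qed

text \<open>Dirichlet convolution: the double series converges absolutely, and grouping the pairs
  with product \<open>n\<close> leaves the divisor sum of \<open>mangoldt\<close>, which is
  \<open>ln n\<close>. This yields \<open>-zeta'\<close> as a product, without an Euler product and
  without dividing by zeta.\<close>

lemma mangoldt_series_times_zeta_series:
  assumes s: "Re s > 1"
  shows "(\<lambda>n. of_real (ln (real (Suc n))) * invpow (real (Suc n)) s) sums (mangoldt_series s * zeta_series s)"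
proof -
  define P where "P = (\<lambda>(d::nat, m::nat). mangoldt d * invpow (real d) s * invpow (real m) s)"
  have "(\<lambda>x. norm (P x)) summable_on {0<..} \<times> {0<..}"
    unfolding Infinite_Sum.abs_summable_on_Sigma_iff
  proof safe
    fix d :: nat
    show "(\<lambda>m. norm (P (d, m))) summable_on {0<..}"
      unfolding P_def prod.case norm_mult[of "_ * _"]
      by (intro summable_on_cmult_right zeta_series_has_sum s)
  next
    have "(\<lambda>d. norm (mangoldt d * invpow (real d) s) * (\<Sum>\<^sub>\<infinity>m\<in>{0<..}. norm (invpow (real m) s))) summable_on {0<..}"
      by (intro summable_on_cmult_left mangoldt_series_has_sum s)
    also have "(\<lambda>d. norm (mangoldt d * invpow (real d) s) * (\<Sum>\<^sub>\<infinity>m\<in>{0<..}. norm (invpow (real m) s))) =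
       (\<lambda>d. norm (\<Sum>\<^sub>\<infinity>m\<in>{0<..}. norm (P (d, m))))"
      unfolding P_def prod.case norm_mult[of "_ * _"]
      by (subst infsum_cmult_right') (simp add: abs_mult infsum_nonneg)
    finally show "(\<lambda>d. norm (\<Sum>\<^sub>\<infinity>m\<in>{0<..}. norm (P (d, m)))) summable_on {0<..}" .
  qed
  then obtain S where S: "(P has_sum S) ({0<..} \<times> {0<..})"
    using abs_summable_summable summable_on_def by blast
  have "((\<lambda>d. mangoldt d * invpow (real d) s * zeta_series s) has_sum S) {0<..}"
    by (rule has_sum_SigmaD[OF S])
       (unfold P_def prod.case, intro has_sum_cmult_right zeta_series_has_sum s)
  moreover have "((\<lambda>d. mangoldt d * invpow (real d) s * zeta_series s) has_sum (mangoldt_series s * zeta_series s)) {0<..}"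
    by (intro has_sum_cmult_left mangoldt_series_has_sum s)
  ultimately have S_eq: "S = mangoldt_series s * zeta_series s" by (rule has_sum_unique)
  \<comment> \<open>Pairs of factors \<open>(d, m)\<close> correspond to a product
    \<open>n = d * m\<close> together with its divisor \<open>d\<close>.\<close>
  have "((\<lambda>(n, d). P (d, n div d)) has_sum S) (Sigma {0<..} (\<lambda>n. {d. d dvd n})) \<longleftrightarrow> (P has_sum S) ({0<..} \<times> {0<..})"
    by (rule has_sum_reindex_bij_witness[of _ "\<lambda>(d, m). (d * m, d)" "\<lambda>(n, d). (d, n div d)"])
       (auto elim!: dvdE)
  with S have "((\<lambda>(n, d). P (d, n div d)) has_sum S) (Sigma {0<..} (\<lambda>n. {d. d dvd n}))" by blast
  hence "((\<lambda>n. of_real (ln (real n)) * invpow (real n) s) has_sum S) {0<..}"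
  proof (rule has_sum_SigmaD)
    fix n :: nat assume n: "n \<in> {0<..}"
    have "(\<Sum>d | d dvd n. case (n, d) of (n, d) \<Rightarrow> P (d, n div d)) = (\<Sum>d | d dvd n. mangoldt d * invpow (real n) s)"
    proof (rule sum.cong)
      fix d assume "d \<in> {d. d dvd n}"
      then obtain m where m: "n = d * m" by (auto elim: dvdE)
      hence "d > 0" "m > 0" using n by auto
      thus "(case (n, d) of (n, d) \<Rightarrow> P (d, n div d)) = mangoldt d * invpow (real n) s"
        by (simp add: P_def m invpow_mult)
    qed simp
    also have "\<dots> = of_real (ln (real n)) * invpow (real n) s"
      using n mangoldt_sum[of n, where 'a=complex] by (simp add: sum_distrib_right[symmetric])
    finally have "of_real (ln (real n)) * invpow (real n) s = (\<Sum>d | d dvd n. case (n, d) of (n, d) \<Rightarrow> P (d, n div d))" by simp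
    thus "((\<lambda>d. case (n, d) of (n, d) \<Rightarrow> P (d, n div d)) has_sum of_real (ln (real n)) * invpow (real n) s) {d. d dvd n}"
      by (intro has_sum_finiteI) (use n in auto)
  qed
  moreover have "bij_betw Suc UNIV {0<..}" by (rule bij_betwI[of _ _ _ "\<lambda>n. n - 1"]) auto
  ultimately have "((\<lambda>n. of_real (ln (real (Suc n))) * invpow (real (Suc n)) s) has_sum S) UNIV"
    using has_sum_reindex_bij_betw[of Suc UNIV "{0<..}" "\<lambda>n. of_real (ln (real n)) * invpow (real n) s" S] by blast
  thus ?thesis using S_eq has_sum_imp_sums by blast
qed

lemma zeta_series_derivative:
  assumes "Re s > 1"
  shows "(zeta_series has_field_derivative (- (mangoldt_series s * zeta_series s))) (at s)"
proof -
  have "((\<lambda>s. \<Sum>n. 1 * invpow (real (Suc n)) s) has_field_derivative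
            (\<Sum>n. 1 * (- of_real (ln (real (Suc n))) * invpow (real (Suc n)) s))) (at s)"
    by (rule dirichlet_series_derivative) (use assms in auto)
  moreover have "(\<lambda>n. - (of_real (ln (real (Suc n))) * invpow (real (Suc n)) s)) sums (- (mangoldt_series s * zeta_series s))"
    by (intro sums_minus mangoldt_series_times_zeta_series assms)
  hence "(\<Sum>n. 1 * (- of_real (ln (real (Suc n))) * invpow (real (Suc n)) s)) = - (mangoldt_series s * zeta_series s)"
    by (simp add: sums_iff)
  ultimately show ?thesis by (simp add: zeta_series_def[abs_def])
qed

lemma isCont_mangoldt_series:
  assumes "Re s > 1"
  shows "isCont mangoldt_series s"
  using dirichlet_series_derivative[of "\<lambda>n. mangoldt (Suc n)", OF norm_mangoldt_Suc_le assms]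
  unfolding mangoldt_series_def[abs_def] by (rule DERIV_isCont)

section \<open>Continuation of \<open>(s - 1) * zeta(s)\<close> to \<open>Re s > 0\<close>\<close>

lemma vector_derivative_bound:
  fixes f :: "real \<Rightarrow> 'a :: real_normed_vector"
  assumes "a \<le> b" and df: "\<And>t. a \<le> t \<Longrightarrow> t \<le> b \<Longrightarrow> (f has_vector_derivative f' t) (at t)"
    and B: "\<And>t. a \<le> t \<Longrightarrow> t \<le> b \<Longrightarrow> norm (f' t) \<le> B"
  shows "norm (f b - f a) \<le> B * (b - a)"
proof (cases "a = b")
  case False
  have "norm (f b - f a) \<le> B * b - B * a"
  proof (rule differentiable_bound_general[where f' = f' and \<phi>' = "\<lambda>_. B"])
    show "continuous_on {a..b} f"
      by (auto intro!: continuous_at_imp_continuous_on has_vector_derivative_continuous df)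
    show "((\<lambda>t. B * t) has_vector_derivative B) (at t)" for t
      unfolding has_real_derivative_iff_has_vector_derivative[symmetric]
      by (auto intro!: derivative_eq_intros)
  qed (use assms False in \<open>auto intro!: continuous_intros\<close>)
  thus ?thesis by (simp add: algebra_simps)
qed simp

text \<open>\<open>zeta_term n s\<close> is \<open>s - 1\<close> times the difference of \<open>(n + 1) ^ -s\<close> and \<open>\<integral> t ^ -s dt\<close> over
  \<open>[n + 1, n + 2]\<close>; the integrals telescope, so that the terms sum to \<open>(s - 1) \<zeta>(s) - 1\<close>.\<close>

definition zeta_term :: "nat \<Rightarrow> complex \<Rightarrow> complex" where
  "zeta_term n s = (s - 1) * invpow (real (Suc n)) s - invpow (real (Suc n)) (s - 1) + invpow (real (Suc n) + 1) (s - 1)"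

text \<open>The term integrates \<open>(s - 1) * (invpow m s - invpow t s)\<close> over
  \<open>t\<close> from \<open>m = n + 1\<close> to \<open>m + 1\<close>. The mean value inequality
  for the integrand gains a factor \<open>norm s / m\<close>, and this extra power of
  \<open>m\<close> gives convergence down to \<open>Re s > 0\<close>.\<close>

lemma zeta_term_bound:
  assumes s: "Re s > 0"
  shows "norm (zeta_term n s) \<le> norm (s - 1) * norm s * real (Suc n) powr (- Re s - 1)"
proof -
  define m where "m = real (Suc n)"
  have m: "m \<ge> 1" by (simp add: m_def)
  have diff: "norm (invpow m s - invpow t s) \<le> norm s * m powr (- Re s - 1)"
    if t: "m \<le> t" "t \<le> m + 1" for t
  proof -
    have "norm (invpow t s - invpow m s) \<le> norm s * m powr (- Re s - 1) * (t - m)"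
    proof (rule vector_derivative_bound[OF t(1)])
      show "((\<lambda>t. invpow t s) has_vector_derivative - s * invpow u s / of_real u) (at u)" if "m \<le> u" for u
        using that m by (intro invpow_has_vector_derivative) auto
      show "norm (- s * invpow u s / of_real u) \<le> norm s * m powr (- Re s - 1)" if "m \<le> u" for u
      proof -
        have "norm (- s * invpow u s / of_real u) = norm s * u powr (- Re s - 1)"
          using that m by (simp add: norm_mult norm_divide norm_invpow_powr powr_diff)
        also have "\<dots> \<le> norm s * m powr (- Re s - 1)"
          using that m s by (intro mult_left_mono powr_mono2') auto
        finally show ?thesis .
      qed
    qed
    also have "\<dots> \<le> norm s * m powr (- Re s - 1) * 1" using t by (intro mult_left_mono) auto
    finally show ?thesis by (simp add: norm_minus_commute)
  qed
  \<comment> \<open>A primitive in \<open>t\<close> of that integrand, with increment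
    \<open>zeta_term n s\<close>. The factor \<open>s - 1\<close> is kept inside, so
    \<open>s = 1\<close> needs no separate treatment.\<close>
  define f where "f = (\<lambda>t. (s - 1) * invpow m s * of_real t + invpow t (s - 1))"
  have "norm (f (m + 1) - f m) \<le> norm (s - 1) * (norm s * m powr (- Re s - 1)) * (m + 1 - m)"
  proof (rule vector_derivative_bound)
    fix t assume t: "m \<le> t" "t \<le> m + 1"
    have "invpow t (s - 1) / of_real t = invpow t s"
    proof -
      have "invpow t (s - 1 + 1) = invpow t (s - 1) * invpow t 1" by (rule invpow_add)
      thus ?thesis using t m by (simp add: invpow_1_right)
    qed
    hence "(s - 1) * invpow m s * 1 + (- (s - 1) * invpow t (s - 1) / of_real t) = (s - 1) * (invpow m s - invpow t s)"
      unfolding times_divide_eq_right[symmetric] by (simp add: algebra_simps)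
    moreover have "(f has_vector_derivative ((s - 1) * invpow m s * 1 + (- (s - 1) * invpow t (s - 1) / of_real t))) (at t)"
      unfolding f_def
      by (intro has_vector_derivative_add has_vector_derivative_mult_right invpow_has_vector_derivative)
         (use t m in \<open>auto intro!: derivative_eq_intros has_vector_derivative_of_real\<close>)
    ultimately show "(f has_vector_derivative (s - 1) * (invpow m s - invpow t s)) (at t)"
      by simp
    show "norm ((s - 1) * (invpow m s - invpow t s)) \<le> norm (s - 1) * (norm s * m powr (- Re s - 1))"
      unfolding norm_mult by (intro mult_left_mono diff t) auto
  qed simp
  also have "f (m + 1) - f m = zeta_term n s"
    by (simp add: f_def zeta_term_def m_def algebra_simps)
  finally show ?thesis by (simp add: m_def mult_ac)
qed

section \<open>The zeta function on the line of abscissa 1\<close>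

text \<open>The continuation of \<open>(s - 1) * zeta(s)\<close>, in which the pole at 1 has become
  the value 1. Its zeros are those of zeta away from 1, so the whole closed half plane can be
  treated uniformly.\<close>

definition zeta_regular :: "complex \<Rightarrow> complex" where
  "zeta_regular s = 1 + (\<Sum>n. zeta_term n s)"

lemma holomorphic_zeta_term: "zeta_term n holomorphic_on A"
  unfolding zeta_term_def[abs_def] by (intro holomorphic_intros)

lemma zeta_term_series:
  "\<exists>g g'. \<forall>s\<in>{s. Re s > 0}. (\<lambda>n. zeta_term n s) sums g s \<and> (\<lambda>n. deriv (zeta_term n) s) sums g' s \<and>
     (g has_field_derivative g' s) (at s)"
proof (rule series_and_derivative_comparison_complex[OF open_halfspace_Re_gt])
  show "(zeta_term n has_field_derivative deriv (zeta_term n) x) (at x)" for n x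
    by (rule holomorphic_derivI[OF holomorphic_zeta_term[of n UNIV]]) auto
next
  fix x :: complex assume "x \<in> {s. Re s > 0}"
  hence x: "Re x > 0" by simp
  define b where "b = Re x / 2"
  \<comment> \<open>Bounds \<open>norm (y - 1) * norm y\<close>, the part of
    \<open>zeta_term_bound\<close> independent of \<open>n\<close>, on the ball of radius
    \<open>b\<close> around \<open>x\<close>.\<close>
  define K where "K = (norm x + b + 1) * (norm x + b)"
  have b: "b > 0" using x by (simp add: b_def)
  define hh where "hh = (\<lambda>n. of_real (K * real (Suc n) powr (-b - 1)) :: complex)"
  have "norm (zeta_term n y) \<le> norm (hh n)" if y: "y \<in> ball x b" for n y
  proof -
    have "Re x - Re y \<le> norm (x - y)" using complex_Re_le_cmod[of "x - y"] by simp
    hence ry: "Re y \<ge> b" using y by (simp add: dist_norm b_def)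
    have "norm y \<le> norm x + norm (y - x)" using norm_triangle_ineq[of x "y - x"] by simp
    hence ny: "norm y \<le> norm x + b" using y by (simp add: dist_norm norm_minus_commute)
    have "norm (y - 1) \<le> norm x + b + 1" using norm_triangle_ineq4[of y 1] ny by simp
    have "norm (zeta_term n y) \<le> norm (y - 1) * norm y * real (Suc n) powr (- Re y - 1)"
      using ry b by (intro zeta_term_bound) auto
    also have "\<dots> \<le> (norm x + b + 1) * (norm x + b) * real (Suc n) powr (-b - 1)"
      by (intro mult_mono \<open>norm (y - 1) \<le> _\<close> ny powr_mono) (use ry b in auto)
    finally show ?thesis unfolding hh_def norm_of_real K_def by (rule order.trans[OF _ abs_ge_self])
  qed
  moreover have "summable hh"
    unfolding hh_def
    by (intro summable_of_real summable_mult, subst summable_Suc_iff[of "\<lambda>n. real n powr (-b - 1)"])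
       (use b in \<open>simp add: summable_real_powr_iff\<close>)
  moreover have "range hh \<subseteq> \<real>\<^sub>\<ge>\<^sub>0" using b by (auto simp: hh_def K_def)
  ultimately show "\<exists>d h. 0 < d \<and> summable h \<and> range h \<subseteq> \<real>\<^sub>\<ge>\<^sub>0 \<and>
      (\<forall>\<^sub>F n in sequentially. \<forall>y\<in>ball x d \<inter> {s. 0 < Re s}. cmod (zeta_term n y) \<le> cmod (h n))"
    using b by (intro exI[of _ b] exI[of _ hh]) auto
qed

lemma holomorphic_zeta_regular: "zeta_regular holomorphic_on {s. Re s > 0}"
proof -
  obtain g g' where g: "\<And>s. Re s > 0 \<Longrightarrow> (\<lambda>n. zeta_term n s) sums g s"
     "\<And>s. Re s > 0 \<Longrightarrow> (g has_field_derivative g' s) (at s)"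
    using zeta_term_series by auto
  have "(\<lambda>s. 1 + g s) holomorphic_on {s. Re s > 0}"
    by (intro holomorphic_intros, subst holomorphic_on_open[OF open_halfspace_Re_gt]) (use g(2) in auto)
  thus ?thesis
    by (rule holomorphic_transform) (use g(1) in \<open>auto simp: zeta_regular_def sums_iff\<close>)
qed

lemma zeta_regular_1 [simp]: "zeta_regular 1 = 1"
proof -
  have "zeta_term n 1 = 0" for n by (simp add: zeta_term_def)
  thus ?thesis by (simp add: zeta_regular_def)
qed

lemma zeta_regular_eq:
  assumes s: "Re s > 1"
  shows "zeta_regular s = (s - 1) * zeta_series s"
proof -
  have "summable (\<lambda>n. norm (1 * invpow (real (Suc n)) s))"
    by (rule dirichlet_series_abs_summable) (use s in auto)
  hence "summable (\<lambda>n. invpow (real (Suc n)) s)"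
    using summable_norm_cancel[of "\<lambda>n. invpow (real (Suc n)) s"] by simp
  hence "(\<lambda>n. invpow (real (Suc n)) s) sums zeta_series s"
    unfolding zeta_series_def by (rule summable_sums)
  hence 1: "(\<lambda>N. \<Sum>n<N. invpow (real (Suc n)) s) \<longlonglongrightarrow> zeta_series s" by (simp add: sums_def)
  have 2: "(\<lambda>N. invpow (real N + 1) (s - 1)) \<longlonglongrightarrow> 0"
  proof (rule tendsto_norm_zero_cancel)
    have "(\<lambda>N. (real N + 1) powr (- (Re s - 1))) \<longlonglongrightarrow> 0"
      by (intro tendsto_neg_powr, use s in simp)
         (subst add.commute, intro filterlim_tendsto_add_at_top[OF tendsto_const] filterlim_real_sequentially)
    thus "(\<lambda>N. norm (invpow (real N + 1) (s - 1))) \<longlonglongrightarrow> 0"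
      by (simp add: norm_invpow_powr)
  qed
  have "(\<Sum>n<N. zeta_term n s) = (s - 1) * (\<Sum>n<N. invpow (real (Suc n)) s) - 1 + invpow (real N + 1) (s - 1)" for N
  proof (induction N)
    case (Suc N)
    have "(\<Sum>n<Suc N. zeta_term n s) = (\<Sum>n<N. zeta_term n s) + zeta_term N s" by simp
    thus ?case unfolding Suc.IH by (simp add: zeta_term_def algebra_simps)
  qed simp
  moreover have "(\<lambda>N. (s - 1) * (\<Sum>n<N. invpow (real (Suc n)) s) - 1 + invpow (real N + 1) (s - 1)) \<longlonglongrightarrow> (s - 1) * zeta_series s - 1 + 0"
    by (intro tendsto_intros 1 2)
  ultimately have "(\<lambda>n. zeta_term n s) sums ((s - 1) * zeta_series s - 1)" by (simp add: sums_def)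
  thus ?thesis by (simp add: zeta_regular_def sums_iff)
qed

text \<open>The logarithmic derivative is \<open>1 / (s - 1) - mangoldt_series s\<close>; it is
  cleared of denominators because the absence of zeros is only derived later from this
  identity.\<close>

lemma deriv_zeta_regular:
  assumes s: "Re s > 1"
  shows "(s - 1) * deriv zeta_regular s = zeta_regular s - (s - 1) * zeta_regular s * mangoldt_series s"
proof -
  have "((\<lambda>s. (s - 1) * zeta_series s) has_field_derivative
      (1 * zeta_series s + (- (mangoldt_series s * zeta_series s)) * (s - 1))) (at s)"
    by (intro DERIV_mult zeta_series_derivative s) (auto intro!: derivative_eq_intros)
  hence "(zeta_regular has_field_derivative
      (1 * zeta_series s + (- (mangoldt_series s * zeta_series s)) * (s - 1))) (at s)"
    by (rule has_field_derivative_transform_within_open[OF _ open_halfspace_Re_gt[of 1]])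
       (use s in \<open>auto simp: zeta_regular_eq\<close>)
  hence "deriv zeta_regular s = zeta_series s - (s - 1) * (mangoldt_series s * zeta_series s)"
    by (simp add: DERIV_imp_deriv mult_ac)
  hence "(s - 1) * deriv zeta_regular s = (s - 1) * (zeta_series s - (s - 1) * (mangoldt_series s * zeta_series s))"
    by (rule arg_cong)
  thus ?thesis unfolding zeta_regular_eq[OF s] by (simp add: algebra_simps)
qed

text \<open>With \<open>m\<close> the order of \<open>f\<close> at \<open>z\<close>, the logarithmic
  derivative is \<open>m / (w - z)\<close> plus a function continuous at \<open>z\<close>. The limit
  is taken only along \<open>w = z + e\<close> with \<open>e > 0\<close>, the direction in which
  Dirichlet series are available from a point of the boundary line.\<close>

lemma logderiv_limit_order:
  assumes f: "f holomorphic_on S" and S: "open S" "connected S" and z: "z \<in> S"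
    and nc: "\<not> f constant_on S"
  obtains m :: nat where "f z = 0 \<longleftrightarrow> m > 0"
    "((\<lambda>e::real. of_real e * (deriv f (z + of_real e) / f (z + of_real e))) \<longlongrightarrow> of_nat m) (at_right 0)"
    "eventually (\<lambda>e::real. f (z + of_real e) \<noteq> 0) (at_right 0)"
proof -
  obtain g r m where m: "f z = 0 \<longleftrightarrow> m > 0" and r: "r > 0" and rS: "ball z r \<subseteq> S" and g: "g holomorphic_on ball z r"
    and fg: "\<And>w. w \<in> ball z r \<Longrightarrow> f w = (w - z) ^ m * g w"
    and g0: "\<And>w. w \<in> ball z r \<Longrightarrow> g w \<noteq> 0"
  proof (cases "f z = 0")
    case True
    obtain g r n where "0 < n" "0 < r" "ball z r \<subseteq> S" "g holomorphic_on ball z r"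
      "\<And>w. w \<in> ball z r \<Longrightarrow> f w = (w - z) ^ n * g w" "\<And>w. w \<in> ball z r \<Longrightarrow> g w \<noteq> 0"
      by (rule holomorphic_factor_zero_nonconstant[OF f S z True nc]) (rule that; assumption)
    thus ?thesis using True by (intro that[of n r g]) simp_all
  next
    case False
    have "continuous_on S f" by (rule holomorphic_on_imp_continuous_on[OF f])
    hence "\<exists>\<epsilon>>0. \<forall>w. dist z w < \<epsilon> \<longrightarrow> f w \<noteq> 0"
      using S(1) z False by (rule continuous_on_open_avoid)
    then obtain r1 where r1: "r1 > 0" "\<And>w. dist z w < r1 \<Longrightarrow> f w \<noteq> 0" by blast
    obtain r2 where r2: "r2 > 0" "ball z r2 \<subseteq> S" using S(1) z open_contains_ball by blast
    have "ball z (min r1 r2) \<subseteq> S" using r2 by auto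
    thus ?thesis using r1 r2 False
      by (intro that[of 0 "min r1 r2" f]) (auto intro: holomorphic_on_subset[OF f])
  qed
  have op: "open (ball z r)" and z': "z \<in> ball z r" using r by auto
  have ev: "eventually (\<lambda>e::real. 0 < e \<and> z + of_real e \<in> ball z r) (at_right 0)"
    using eventually_at_right_less[of 0] eventually_at_right_field[of "\<lambda>e. e < r" 0] r
    by (auto simp: eventually_at_right_field dist_norm intro!: exI[of _ r])
  have eq: "of_real e * (deriv f (z + of_real e) / f (z + of_real e)) =
      of_nat m + of_real e * (deriv g (z + of_real e) / g (z + of_real e))"
    and nz: "f (z + of_real e) \<noteq> 0" if e: "0 < e" "z + of_real e \<in> ball z r" for e :: real
  proof -
    let ?w = "z + complex_of_real e"
    have "(g has_field_derivative deriv g ?w) (at ?w)"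
      by (rule holomorphic_derivI[OF g op e(2)])
    hence "((\<lambda>w. (w - z) ^ m * g w) has_field_derivative
       (of_nat m * (?w - z) ^ (m - 1) * g ?w + (?w - z) ^ m * deriv g ?w)) (at ?w)"
      by (auto intro!: derivative_eq_intros simp: algebra_simps)
    hence "(f has_field_derivative
       (of_nat m * (?w - z) ^ (m - 1) * g ?w + (?w - z) ^ m * deriv g ?w)) (at ?w)"
      by (rule has_field_derivative_transform_within_open[OF _ op e(2)]) (simp add: fg)
    hence d: "deriv f ?w = of_nat m * of_real e ^ (m - 1) * g ?w + of_real e ^ m * deriv g ?w"
      by (simp add: DERIV_imp_deriv)
    have fw: "f ?w = of_real e ^ m * g ?w" using fg[OF e(2)] by simp
    show "f ?w \<noteq> 0" using fw g0[OF e(2)] e(1) by simp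
    \<comment> \<open>For \<open>m = 0\<close> the exponent \<open>m - 1\<close> is truncated, but
      its term then has coefficient 0.\<close>
    show "of_real e * (deriv f ?w / f ?w) = of_nat m + of_real e * (deriv g ?w / g ?w)"
      using g0[OF e(2)] e(1) unfolding d fw by (cases m) (simp_all add: field_simps)
  qed
  have "((\<lambda>e::real. of_nat m + of_real e * (deriv g (z + of_real e) / g (z + of_real e))) \<longlongrightarrow>
       of_nat m + of_real 0 * (deriv g (z + of_real 0) / g (z + of_real 0))) (at_right 0)"
  proof -
    have c1: "isCont g z" "isCont (deriv g) z"
      using holomorphic_on_imp_continuous_on[OF g] holomorphic_on_imp_continuous_on[OF holomorphic_deriv[OF g op]]
        op z' by (auto simp: continuous_on_eq_continuous_at)
    have t: "((\<lambda>e::real. z + of_real e) \<longlongrightarrow> z) (at_right 0)" by (auto intro!: tendsto_eq_intros)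
    have "((\<lambda>e::real. g (z + of_real e)) \<longlongrightarrow> g (z + of_real 0)) (at_right 0)"
         "((\<lambda>e::real. deriv g (z + of_real e)) \<longlongrightarrow> deriv g (z + of_real 0)) (at_right 0)"
      using isCont_tendsto_compose[OF c1(1) t] isCont_tendsto_compose[OF c1(2) t] by simp_all
    thus ?thesis using g0[OF z'] by (intro tendsto_intros) auto
  qed
  hence "((\<lambda>e::real. of_nat m + of_real e * (deriv g (z + of_real e) / g (z + of_real e))) \<longlongrightarrow> of_nat m) (at_right 0)"
    by simp
  hence "((\<lambda>e::real. of_real e * (deriv f (z + of_real e) / f (z + of_real e))) \<longlongrightarrow> of_nat m) (at_right 0)"
    by (rule Lim_transform_eventually) (use ev in eventually_elim, use eq in simp)
  moreover have "eventually (\<lambda>e::real. f (z + of_real e) \<noteq> 0) (at_right 0)"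
    using ev by eventually_elim (use nz in blast)
  ultimately show ?thesis using that m by blast
qed



text \<open>The limit is the residue of \<open>-zeta'/zeta\<close> at \<open>z\<close>: 1 from the
  pole of zeta at 1, minus the multiplicity \<open>m\<close> of a zero. Points to the right of
  \<open>z\<close> have real part above 1, where \<open>mangoldt_series\<close> is given by its
  series.\<close>

lemma mangoldt_series_pole_order:
  assumes z: "Re z \<ge> 1" and nc: "\<not> zeta_regular constant_on {s. Re s > 0}"
  obtains m :: nat where "zeta_regular z = 0 \<longleftrightarrow> m > 0"
    "((\<lambda>e::real. of_real e * mangoldt_series (z + of_real e)) \<longlongrightarrow> (if z = 1 then 1 else 0) - of_nat m) (at_right 0)"
proof -
  have conn: "connected {s. Re s > 0}" by (intro convex_connected convex_halfspace_Re_gt)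
  have "z \<in> {s. Re s > 0}" using z by simp
  then obtain m :: nat where m: "zeta_regular z = 0 \<longleftrightarrow> m > 0"
    "((\<lambda>e::real. of_real e * (deriv zeta_regular (z + of_real e) / zeta_regular (z + of_real e))) \<longlongrightarrow> of_nat m) (at_right 0)"
    "eventually (\<lambda>e::real. zeta_regular (z + of_real e) \<noteq> 0) (at_right 0)"
    by (rule logderiv_limit_order[OF holomorphic_zeta_regular open_halfspace_Re_gt conn _ nc])
  have "((\<lambda>e::real. of_real e / (z + of_real e - 1)) \<longlongrightarrow> (if z = 1 then 1 else 0)) (at_right 0)"
  proof (cases "z = 1")
    case True
    have "((\<lambda>e::real. 1 :: complex) \<longlongrightarrow> 1) (at_right 0)" by simp
    hence "((\<lambda>e::real. of_real e / (z + of_real e - 1)) \<longlongrightarrow> 1) (at_right 0)"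
      by (rule Lim_transform_eventually)
         (use eventually_at_right_less[of 0] in eventually_elim, simp add: True)
    thus ?thesis using True by simp
  next
    case False
    have "((\<lambda>e::real. of_real e / (z + of_real e - 1)) \<longlongrightarrow> of_real 0 / (z + of_real 0 - 1)) (at_right 0)"
      using False by (intro tendsto_intros) auto
    thus ?thesis using False by simp
  qed
  from tendsto_diff[OF this m(2)]
  have "((\<lambda>e::real. of_real e * mangoldt_series (z + of_real e)) \<longlongrightarrow> (if z = 1 then 1 else 0) - of_nat m) (at_right 0)"
  proof (rule Lim_transform_eventually)
    show "eventually (\<lambda>e::real. of_real e / (z + of_real e - 1) -
        of_real e * (deriv zeta_regular (z + of_real e) / zeta_regular (z + of_real e)) =
        of_real e * mangoldt_series (z + of_real e)) (at_right 0)"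
      using m(3) eventually_at_right_less[of 0]
    proof eventually_elim
      case (elim e)
      define w where "w = z + of_real e"
      have w: "Re w > 1" using z elim by (simp add: w_def)
      hence w1: "w - 1 \<noteq> 0" by (auto simp: complex_eq_iff)
      have w0: "zeta_regular w \<noteq> 0" using elim by (simp add: w_def)
      have "deriv zeta_regular w = (zeta_regular w - (w - 1) * zeta_regular w * mangoldt_series w) / (w - 1)"
        using deriv_zeta_regular[OF w] w1 by (simp add: field_simps)
      hence "deriv zeta_regular w / zeta_regular w = 1 / (w - 1) - mangoldt_series w"
        using w0 w1 by (simp add: diff_divide_distrib)
      thus ?case unfolding w_def[symmetric] by (simp add: right_diff_distrib)
    qed
  qed
  thus ?thesis using that m(1) by blast
qed

text \<open>The terms carry the factor \<open>3 + 4 cos x + cos (2 x) = 2 (1 + cos x)\<^sup>2\<close> with \<open>x = t ln n\<close>.\<close>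

lemma mangoldt_series_3_4_1:
  assumes x: "x > 1"
  shows "Re (3 * mangoldt_series (of_real x) + 4 * mangoldt_series (of_real x + \<i> * of_real t) +
             mangoldt_series (of_real x + \<i> * of_real (2 * t))) \<ge> 0"
proof -
  define c where "c = (\<lambda>n. mangoldt (Suc n) :: complex)"
  have S: "(\<lambda>n. c n * invpow (real (Suc n)) s) sums mangoldt_series s" if "Re s > 1" for s
    unfolding mangoldt_series_def c_def
    by (intro summable_sums, rule summable_norm_cancel, rule dirichlet_series_abs_summable)
       (use that norm_mangoldt_Suc_le in auto)
  have "(\<lambda>n. Re (3 * (c n * invpow (real (Suc n)) (of_real x)) +
       4 * (c n * invpow (real (Suc n)) (of_real x + \<i> * of_real t)) +
       c n * invpow (real (Suc n)) (of_real x + \<i> * of_real (2 * t)))) sums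
    Re (3 * mangoldt_series (of_real x) + 4 * mangoldt_series (of_real x + \<i> * of_real t) +
             mangoldt_series (of_real x + \<i> * of_real (2 * t)))"
    by (intro sums_Re sums_add sums_mult S) (use x in auto)
  from sums_zero this show ?thesis
  proof (rule sums_le[rotated])
    fix n
    define l where "l = ln (real (Suc n))"
    have "Re (invpow (real (Suc n)) (of_real x + \<i> * of_real u)) = exp (-(x * l)) * cos (u * l)" for u
      unfolding invpow_def l_def[symmetric] by (simp add: Re_exp)
    from this[of 0] this[of t] this[of "2*t"]
    have "Re (3 * (c n * invpow (real (Suc n)) (of_real x)) +
       4 * (c n * invpow (real (Suc n)) (of_real x + \<i> * of_real t)) +
       c n * invpow (real (Suc n)) (of_real x + \<i> * of_real (2 * t))) =
       mangoldt (Suc n) * exp (-(x * l)) * (3 + 4 * cos (t * l) + cos (2 * (t * l)))"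
      by (simp add: c_def algebra_simps)
    also have "3 + 4 * cos (t * l) + cos (2 * (t * l)) = 2 * (1 + cos (t * l))\<^sup>2"
      unfolding cos_double_cos by (simp add: power2_eq_square algebra_simps)
    also have "mangoldt (Suc n) * exp (-(x * l)) * (2 * (1 + cos (t * l))\<^sup>2) \<ge> 0"
      by (intro mult_nonneg_nonneg mangoldt_nonneg) auto
    finally show "0 \<le> Re (3 * (c n * invpow (real (Suc n)) (of_real x)) +
       4 * (c n * invpow (real (Suc n)) (of_real x + \<i> * of_real t)) +
       c n * invpow (real (Suc n)) (of_real x + \<i> * of_real (2 * t)))" .
  qed
qed

text \<open>If \<open>1 + \<i> * t\<close> is a zero of order \<open>m\<close> and
  \<open>1 + 2 * \<i> * t\<close> one of order \<open>m2\<close>, then \<open>e\<close> times the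
  nonnegative 3-4-1 combination at abscissa \<open>1 + e\<close> tends to
  \<open>3 - 4 * m - m2\<close>, which is negative as soon as \<open>m \<ge> 1\<close>.\<close>

theorem zeta_regular_nonzero:
  assumes z: "Re z \<ge> 1"
  shows "zeta_regular z \<noteq> 0"
proof
  assume zero: "zeta_regular z = 0"
  have nc: "\<not> zeta_regular constant_on {s. Re s > 0}"
  proof
    assume "zeta_regular constant_on {s. Re s > 0}"
    then obtain c where "\<And>s. Re s > 0 \<Longrightarrow> zeta_regular s = c" by (auto simp: constant_on_def)
    from this[of z] this[of 1] show False using zero z by simp
  qed
  have "z \<noteq> 1" using zero by auto
  obtain m :: nat where "zeta_regular z = 0 \<longleftrightarrow> m > 0"
    "((\<lambda>e::real. of_real e * mangoldt_series (z + of_real e)) \<longlongrightarrow> (if z = 1 then 1 else 0) - of_nat m) (at_right 0)"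
    by (rule mangoldt_series_pole_order[OF z nc])
  hence m: "m > 0" "((\<lambda>e::real. of_real e * mangoldt_series (z + of_real e)) \<longlongrightarrow> - of_nat m) (at_right 0)"
    using zero \<open>z \<noteq> 1\<close> by simp_all
  show False
  proof (cases "Re z > 1")
    \<comment> \<open>Inside the half plane of convergence \<open>mangoldt_series\<close> is
      continuous, so the limit is 0 and cannot be \<open>-m\<close>.\<close>
    case True
    have "((\<lambda>e::real. z + of_real e) \<longlongrightarrow> z) (at_right 0)" by (auto intro!: tendsto_eq_intros)
    from isCont_tendsto_compose[OF isCont_mangoldt_series[OF True] this]
    have "((\<lambda>e::real. of_real e * mangoldt_series (z + of_real e)) \<longlongrightarrow> of_real 0 * mangoldt_series z) (at_right 0)"
      by (intro tendsto_intros)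
    hence "((\<lambda>e::real. of_real e * mangoldt_series (z + of_real e)) \<longlongrightarrow> 0) (at_right 0)" by simp
    from tendsto_unique[OF _ this m(2)] m(1) show False by simp
  next
    case False
    define t where "t = Im z"
    have zt: "z = 1 + \<i> * of_real t" using False z by (simp add: t_def complex_eq_iff)
    have "t \<noteq> 0" using zt \<open>z \<noteq> 1\<close> by auto
    define z2 where "z2 = 1 + \<i> * of_real (2 * t)"
    have "z2 \<noteq> 1" using \<open>t \<noteq> 0\<close> by (simp add: z2_def)
    have "Re z2 \<ge> 1" by (simp add: z2_def)
    then obtain m2 :: nat where
      "((\<lambda>e::real. of_real e * mangoldt_series (z2 + of_real e)) \<longlongrightarrow> (if z2 = 1 then 1 else 0) - of_nat m2) (at_right 0)"
      by (rule mangoldt_series_pole_order[OF _ nc])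
    hence m2: "((\<lambda>e::real. of_real e * mangoldt_series (z2 + of_real e)) \<longlongrightarrow> - of_nat m2) (at_right 0)"
      using \<open>z2 \<noteq> 1\<close> by simp
    have "Re 1 \<ge> 1" by simp
    then obtain m0 :: nat where "zeta_regular 1 = 0 \<longleftrightarrow> m0 > 0" and
      "((\<lambda>e::real. of_real e * mangoldt_series (1 + of_real e)) \<longlongrightarrow> (if (1::complex) = 1 then 1 else 0) - of_nat m0) (at_right 0)"
      by (rule mangoldt_series_pole_order[OF _ nc])
    hence m0: "((\<lambda>e::real. of_real e * mangoldt_series (1 + of_real e)) \<longlongrightarrow> 1) (at_right 0)" by simp
    define F where "F = (\<lambda>e::real. 3 * (of_real e * mangoldt_series (1 + of_real e)) +
       4 * (of_real e * mangoldt_series (z + of_real e)) + of_real e * mangoldt_series (z2 + of_real e))"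
    have "((\<lambda>e. Re (F e)) \<longlongrightarrow> Re (3 * 1 + 4 * (- of_nat m) + (- of_nat m2))) (at_right 0)"
      unfolding F_def by (intro tendsto_intros m m0 m2)
    moreover have "eventually (\<lambda>e. Re (F e) \<ge> 0) (at_right 0)"
      using eventually_at_right_less[of 0]
    proof eventually_elim
      case (elim e)
      have "F e = of_real e * (3 * mangoldt_series (of_real (1 + e)) + 4 * mangoldt_series (of_real (1 + e) + \<i> * of_real t) +
             mangoldt_series (of_real (1 + e) + \<i> * of_real (2 * t)))"
        by (simp add: F_def zt z2_def algebra_simps)
      thus ?case using mangoldt_series_3_4_1[of "1 + e" t] elim by (simp del: of_real_add)
    qed
    ultimately have "Re (3 * 1 + 4 * (- of_nat m) + (- of_nat m2)) \<ge> 0"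
      by (intro tendsto_lowerbound) auto
    thus False using m(1) by simp
  qed
qed

text \<open>The coefficients \<open>mangoldt n - 1\<close> have partial sums
  \<open>psi n - n\<close>, and subtracting zeta from \<open>-zeta'/zeta\<close> cancels the simple
  poles at 1. The absence of zeros on the boundary line makes the difference holomorphic on a
  neighbourhood of \<open>Re s \<ge> 1\<close>.\<close>

theorem psi_asymptotics: "(\<lambda>n. psi n / real n) \<longlonglongrightarrow> 1"
proof -
  define a :: "nat \<Rightarrow> complex" where "a = (\<lambda>n. mangoldt n - 1)"
  have A: "(\<Sum>k=1..n. a k) = of_real (psi n - real n)" for n
    by (simp add: a_def psi_def sum_subtractf)
  define U where "U = {s. Re s > 0} \<inter> zeta_regular -` (-{0})"
  \<comment> \<open>From \<open>1 / (s - 1) - zeta_regular s / (s - 1)\<close>: since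
    \<open>zeta_regular 1 = 1\<close>, this is minus a difference quotient at 1, with the derivative
    as its value there.\<close>
  define G where "G = (\<lambda>s. - (if s = 1 then deriv zeta_regular 1 else (zeta_regular s - zeta_regular 1) / (s - 1)) -
     deriv zeta_regular s / zeta_regular s)"
  have U: "open U" unfolding U_def
    by (intro continuous_open_preimage holomorphic_on_imp_continuous_on holomorphic_zeta_regular open_halfspace_Re_gt) auto
  have "(\<lambda>n. (\<Sum>k=1..Suc n. a k) / of_real (real (Suc n) * (real (Suc n) + 1))) sums G 1"
  proof (rule newman_tauberian[where C = "4 * ln 2 + 1" and U = U])
    fix n
    have "psi n \<ge> 0" unfolding psi_def by (intro sum_nonneg mangoldt_nonneg)
    hence "\<bar>psi n - real n\<bar> \<le> psi n + real n" by linarith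
    also have "\<dots> \<le> (4 * ln 2 + 1) * real n" using psi_le[of n] by (simp add: algebra_simps)
    finally show "norm (\<Sum>k=1..n. a k) \<le> (4 * ln 2 + 1) * real n" unfolding A norm_of_real .
  next
    have h1: "(\<lambda>s. if s = 1 then deriv zeta_regular 1 else (zeta_regular s - zeta_regular 1) / (s - 1)) holomorphic_on U"
      by (rule pole_lemma_open[OF _ U], rule holomorphic_on_subset[OF holomorphic_zeta_regular]) (auto simp: U_def)
    have h2: "zeta_regular holomorphic_on U"
      by (rule holomorphic_on_subset[OF holomorphic_zeta_regular]) (auto simp: U_def)
    have h3: "deriv zeta_regular holomorphic_on U"
      by (rule holomorphic_deriv[OF h2 U])
    show "G holomorphic_on U"
      unfolding G_def
      by (intro holomorphic_on_diff holomorphic_on_minus holomorphic_on_divide h1 h2 h3) (auto simp: U_def)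
    show "open U" by (rule U)
    show "{s. Re s \<ge> 1} \<subseteq> U" using zeta_regular_nonzero by (auto simp: U_def)
  next
    fix s :: complex assume s: "Re s > 1"
    have s1: "s \<noteq> 1" using s by auto
    have "(\<lambda>n. mangoldt (Suc n) * invpow (real (Suc n)) s) sums mangoldt_series s"
      unfolding mangoldt_series_def
      by (intro summable_sums, rule summable_norm_cancel, rule dirichlet_series_abs_summable)
         (use s norm_mangoldt_Suc_le in auto)
    moreover have "(\<lambda>n. 1 * invpow (real (Suc n)) s) sums (\<Sum>n. 1 * invpow (real (Suc n)) s)"
      by (intro summable_sums, rule summable_norm_cancel, rule dirichlet_series_abs_summable) (use s in auto)
    ultimately have "(\<lambda>n. mangoldt (Suc n) * invpow (real (Suc n)) s - 1 * invpow (real (Suc n)) s) sums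
        (mangoldt_series s - (\<Sum>n. 1 * invpow (real (Suc n)) s))" by (rule sums_diff)
    hence "(\<lambda>n. a (Suc n) * invpow (real (Suc n)) s) sums (mangoldt_series s - zeta_series s)"
      by (simp add: a_def zeta_series_def left_diff_distrib)
    moreover have "mangoldt_series s - zeta_series s = G s"
    proof -
      have "deriv zeta_regular s = (zeta_regular s - (s - 1) * zeta_regular s * mangoldt_series s) / (s - 1)"
        using deriv_zeta_regular[OF s] s1 by (simp add: field_simps)
      hence "deriv zeta_regular s / zeta_regular s = 1 / (s - 1) - mangoldt_series s"
        using zeta_regular_nonzero[of s] s s1 by (simp add: diff_divide_distrib)
      moreover have "zeta_series s = zeta_regular s / (s - 1)" using zeta_regular_eq[OF s] s1 by simp
      ultimately show ?thesis using s1 by (simp add: G_def diff_divide_distrib)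
    qed
    ultimately show "(\<lambda>n. a (Suc n) * invpow (real (Suc n)) s) sums G s" by simp
  qed
  hence "summable (\<lambda>n. complex_of_real ((psi (Suc n) - real (Suc n)) / (real (Suc n) * (real (Suc n) + 1))))"
    unfolding A by (simp add: sums_iff)
  hence "summable (\<lambda>n. (psi (Suc n) - real (Suc n)) / (real (Suc n) * (real (Suc n) + 1)))"
    by (simp only: summable_of_real_iff)
  hence "summable (\<lambda>n. (psi n - real n) / (real n * (real n + 1)))"
    by (subst (asm) summable_Suc_iff[of "\<lambda>n. (psi n - real n) / (real n * (real n + 1))"])
  thus ?thesis by (intro psi_asymp_from_summable) (simp add: add.commute)
qed

section \<open>The prime number theorem\<close>

definition theta :: "nat \<Rightarrow> real" where
  "theta n = (\<Sum>p | prime p \<and> p \<le> n. ln (real p))"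

lemma finite_primes_le [simp]: "finite {p::nat. prime p \<and> p \<le> n}"
  by (rule finite_subset[of _ "{..n}"]) auto

lemma theta_le_psi: "theta n \<le> psi n"
proof -
  have "theta n = (\<Sum>p | prime p \<and> p \<le> n. mangoldt p)"
    unfolding theta_def by (intro sum.cong) auto
  also have "\<dots> \<le> psi n"
    unfolding psi_def by (intro sum_mono2) (auto simp: mangoldt_nonneg Suc_le_eq prime_gt_0_nat)
  finally show ?thesis .
qed

text \<open>Only powers \<open>p ^ j\<close> with \<open>j \<ge> 2\<close> remain. They have
  \<open>p \<le> sqrt n\<close> and \<open>j \<le> log 2 n\<close>, and each contributes at most
  \<open>ln n\<close>; this crude count is already \<open>o(n)\<close>.\<close>

lemma psi_minus_theta_le:
  assumes n: "n \<ge> 1"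
  shows "psi n - theta n \<le> (sqrt (real n) + 1) * (log 2 (real n) + 1) * ln (real n)"
proof -
  define B where "B = {k\<in>{1..n}. primepow k \<and> \<not>prime k}"
  define a where "a = nat \<lfloor>sqrt (real n)\<rfloor>"
  define b where "b = nat \<lfloor>log 2 (real n)\<rfloor>"
  have l0: "log 2 (real n) \<ge> 0" using n by simp
  have "{1..n} = {p. prime p \<and> p \<le> n} \<union> {k\<in>{1..n}. \<not>prime k}"
    by (auto simp: Suc_le_eq prime_gt_0_nat)
  hence "psi n = (\<Sum>k\<in>{p. prime p \<and> p \<le> n} \<union> {k\<in>{1..n}. \<not>prime k}. mangoldt k)"
    by (simp only: psi_def)
  also have "\<dots> = (\<Sum>p | prime p \<and> p \<le> n. mangoldt p) + (\<Sum>k\<in>{k\<in>{1..n}. \<not>prime k}. mangoldt k)"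
    by (rule sum.union_disjoint) auto
  also have "(\<Sum>p | prime p \<and> p \<le> n. mangoldt p) = theta n"
    unfolding theta_def by (intro sum.cong) auto
  also have "(\<Sum>k\<in>{k\<in>{1..n}. \<not>prime k}. mangoldt k) = (\<Sum>k\<in>B. mangoldt k)"
    by (intro sum.mono_neutral_right) (auto simp: B_def mangoldt_def)
  finally have "psi n - theta n = (\<Sum>k\<in>B. mangoldt k)" by simp
  also have "\<dots> \<le> real (card B) * ln (real n)"
  proof (rule sum_bounded_above)
    fix k assume k: "k \<in> B"
    hence "mangoldt k \<le> ln (real k)" by (intro mangoldt_le) (auto simp: B_def)
    also have "\<dots> \<le> ln (real n)" using k by (auto simp: B_def)
    finally show "mangoldt k \<le> ln (real n)" .
  qed
  also have "real (card B) \<le> (sqrt (real n) + 1) * (log 2 (real n) + 1)"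
  proof -
    have "B \<subseteq> (\<lambda>(p, j). p ^ j) ` ({..a} \<times> {..b})"
    proof
      fix k assume k: "k \<in> B"
      then obtain p j where p: "prime p" "j > 0" "k = p ^ j" by (auto simp: B_def primepow_def)
      have "j \<noteq> 1" using k p by (auto simp: B_def)
      hence j: "j \<ge> 2" using p by simp
      have "k \<le> n" using k by (simp add: B_def)
      have "p ^ 2 \<le> p ^ j" using j prime_ge_1_nat[OF p(1)] by (intro power_increasing) auto
      hence "real (p ^ 2) \<le> real n" using \<open>k \<le> n\<close> p(3) by simp
      hence "real p \<le> sqrt (real n)" by (intro real_le_rsqrt) simp
      hence 1: "p \<le> a" unfolding a_def by linarith
      have "2 ^ j \<le> p ^ j" using prime_ge_2_nat[OF p(1)] by (intro power_mono) auto
      hence "real (2 ^ j) \<le> real n" using \<open>k \<le> n\<close> p(3) by simp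
      hence "2 powr real j \<le> real n" by (simp add: powr_realpow)
      hence "real j \<le> log 2 (real n)" using n by (simp add: le_log_iff)
      hence 2: "j \<le> b" unfolding b_def by linarith
      show "k \<in> (\<lambda>(p, j). p ^ j) ` ({..a} \<times> {..b})"
        using 1 2 p(3) by (intro image_eqI[of _ _ "(p, j)"]) auto
    qed
    hence "card B \<le> card ({..a} \<times> {..b})"
      by (intro surj_card_le) auto
    hence "real (card B) \<le> (real a + 1) * (real b + 1)"
      using of_nat_mono[of "card B" "card ({..a} \<times> {..b})", where 'a = real]
      by (simp add: algebra_simps)
    also have "\<dots> \<le> (sqrt (real n) + 1) * (log 2 (real n) + 1)"
      using l0 unfolding a_def b_def by (intro mult_mono add_right_mono) auto
    finally show ?thesis .
  qed
  finally show ?thesis using n by (simp add: mult_right_mono)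
qed

lemma theta_asymptotics: "(\<lambda>n. theta n / real n) \<longlonglongrightarrow> 1"
proof (rule tendsto_sandwich[OF _ _ _ psi_asymptotics])
  have "(\<lambda>n. (sqrt (real n) + 1) * (log 2 (real n) + 1) * ln (real n) / real n) \<longlonglongrightarrow> 0"
    by real_asymp
  from tendsto_diff[OF psi_asymptotics this]
  show "(\<lambda>n. psi n / real n - (sqrt (real n) + 1) * (log 2 (real n) + 1) * ln (real n) / real n) \<longlonglongrightarrow> 1"
    by simp
  show "\<forall>\<^sub>F n in sequentially. psi n / real n - (sqrt (real n) + 1) * (log 2 (real n) + 1) * ln (real n) / real n \<le> theta n / real n"
    using eventually_ge_at_top[of 1]
  proof eventually_elim
    case (elim n)
    have "psi n - (sqrt (real n) + 1) * (log 2 (real n) + 1) * ln (real n) \<le> theta n"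
      using psi_minus_theta_le[OF elim] by linarith
    from divide_right_mono[OF this, of "real n"] show ?case by (simp add: diff_divide_distrib)
  qed
  show "\<forall>\<^sub>F n in sequentially. theta n / real n \<le> psi n / real n"
    by (intro always_eventually allI divide_right_mono theta_le_psi) auto
qed

lemma prime_pi_mono: "m \<le> n \<Longrightarrow> prime_pi m \<le> prime_pi n"
  unfolding prime_pi_def by (intro card_mono) auto

lemma theta_le_prime_pi: "theta n \<le> real (prime_pi n) * ln (real n)"
  unfolding theta_def prime_pi_def
proof (rule sum_bounded_above)
  fix p assume p: "p \<in> {p. prime p \<and> p \<le> n}"
  hence "p > 0" by (simp add: prime_gt_0_nat)
  thus "ln (real p) \<le> ln (real n)" using p by (subst ln_le_cancel_iff) auto
qed

text \<open>At most \<open>y\<close> primes lie below the cut \<open>y\<close>, and each prime above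
  it adds at least \<open>ln y\<close> to \<open>theta n\<close>.\<close>

lemma prime_pi_le_theta:
  assumes y: "y > 1"
  shows "real (prime_pi n) \<le> y + theta n / ln y"
proof -
  define A where "A = {p. prime p \<and> p \<le> n \<and> real p > y}"
  have fin: "finite A" by (rule finite_subset[OF _ finite_primes_le[of n]]) (auto simp: A_def)
  have "{p. prime p \<and> p \<le> n} \<subseteq> {1..nat \<lfloor>y\<rfloor>} \<union> A"
  proof
    fix p assume p: "p \<in> {p. prime p \<and> p \<le> n}"
    hence "p \<ge> 1" by (simp add: Suc_le_eq prime_gt_0_nat)
    thus "p \<in> {1..nat \<lfloor>y\<rfloor>} \<union> A"
      using p by (cases "real p > y") (auto simp: A_def le_nat_floor)
  qed
  hence "prime_pi n \<le> card ({1..nat \<lfloor>y\<rfloor>} \<union> A)"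
    unfolding prime_pi_def using fin by (intro card_mono) auto
  also have "\<dots> \<le> card {1..nat \<lfloor>y\<rfloor>} + card A" by (rule card_Un_le)
  finally have "real (prime_pi n) \<le> real (nat \<lfloor>y\<rfloor>) + real (card A)" by simp
  also have "real (nat \<lfloor>y\<rfloor>) \<le> y" using y by simp
  also have "real (card A) \<le> theta n / ln y"
  proof -
    have "real (card A) * ln y \<le> (\<Sum>p\<in>A. ln (real p))"
      by (rule sum_bounded_below) (use y in \<open>auto simp: A_def\<close>)
    also have "\<dots> \<le> theta n"
      unfolding theta_def
      by (intro sum_mono2) (auto simp: A_def prime_ge_1_nat Suc_le_eq prime_gt_0_nat)
    finally show ?thesis using y by (simp add: field_simps)
  qed
  finally show ?thesis by simp
qed

theorem prime_number_theorem: "(\<lambda>n. real (prime_pi n) * ln (real n) / real n) \<longlonglongrightarrow> 1"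
proof (rule tendsto_sandwich[OF _ _ theta_asymptotics])
  show "\<forall>\<^sub>F n in sequentially. theta n / real n \<le> real (prime_pi n) * ln (real n) / real n"
    by (intro always_eventually allI divide_right_mono theta_le_prime_pi) auto
  have "(\<lambda>n. ln (real n) / ln (real n / ln (real n) ^ 2)) \<longlonglongrightarrow> 1" by real_asymp
  moreover have "(\<lambda>n. 1 / ln (real n)) \<longlonglongrightarrow> 0" by real_asymp
  ultimately have "(\<lambda>n. 1 / ln (real n) + theta n / real n * (ln (real n) / ln (real n / ln (real n) ^ 2))) \<longlonglongrightarrow> 0 + 1 * 1"
    by (intro tendsto_intros theta_asymptotics)
  thus "(\<lambda>n. 1 / ln (real n) + theta n / real n * (ln (real n) / ln (real n / ln (real n) ^ 2))) \<longlonglongrightarrow> 1"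
    by simp
  have "\<forall>\<^sub>F n in sequentially. real n / ln (real n) ^ 2 > 1" by real_asymp
  thus "\<forall>\<^sub>F n in sequentially. real (prime_pi n) * ln (real n) / real n \<le>
      1 / ln (real n) + theta n / real n * (ln (real n) / ln (real n / ln (real n) ^ 2))"
    using eventually_ge_at_top[of 2]
  proof eventually_elim
    case (elim n)
    \<comment> \<open>A cut with \<open>y * ln n / n\<close> tending to 0 and \<open>ln y\<close>
      asymptotic to \<open>ln n\<close>, so that neither term of the estimate costs anything in the
      limit.\<close>
    define y where "y = real n / ln (real n) ^ 2"
    have l: "ln (real n) > 0" using elim by simp
    have "real (prime_pi n) * (ln (real n) / real n) \<le> (y + theta n / ln y) * (ln (real n) / real n)"
      using elim l by (intro mult_right_mono prime_pi_le_theta) (auto simp: y_def)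
    also have "\<dots> = y * (ln (real n) / real n) + theta n / real n * (ln (real n) / ln y)"
      unfolding distrib_right by (simp add: mult_ac)
    also have "y * (ln (real n) / real n) = 1 / ln (real n)"
      using elim l by (simp add: y_def power2_eq_square)
    finally show ?case by (simp add: y_def)
  qed
qed

text \<open>With one common factor \<open>ln m\<close>, prime counts in different intervals can be
  compared by linear arithmetic. For \<open>v\<close> comparable to \<open>m\<close> the quotient
  \<open>ln m / ln v\<close> tends to 1 uniformly; for smaller \<open>v\<close> monotonicity
  suffices, as both quantities are small against \<open>m\<close>.\<close>

lemma prime_pi_uniform:
  assumes "e > 0"
  shows "\<forall>\<^sub>F m in sequentially. \<forall>v\<le>2*m. \<bar>real (prime_pi v) * ln (real m) - real v\<bar> \<le> e * real m"
proof -
  define d where "d = min e 1"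
  have d: "d > 0" "d \<le> 1" "d \<le> e" using assms by (auto simp: d_def)
  have "\<forall>\<^sub>F v in sequentially. dist (real (prime_pi v) * ln (real v) / real v) 1 < d / 8"
    using prime_number_theorem d by (intro tendstoD) auto
  then obtain V where V: "\<And>v. v \<ge> V \<Longrightarrow> dist (real (prime_pi v) * ln (real v) / real v) 1 < d / 8"
    unfolding eventually_sequentially by blast
  have E1: "\<forall>\<^sub>F m in sequentially. ln (real m) / ln (2 * real m) > 1 - d / 8"
    by (rule order_tendstoD[where y = 1]) (real_asymp, use d in auto)
  have E2: "\<forall>\<^sub>F m in sequentially. ln (real m) / ln (d / 8 * real m) < 1 + d / 8"
    by (rule order_tendstoD[where y = 1]) (use d in real_asymp, use d in auto)
  have E3: "\<forall>\<^sub>F m in sequentially. d / 8 * real m > max (real V) 2"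
    using d by (intro filterlim_at_top_dense[THEN iffD1, rule_format] filterlim_tendsto_pos_mult_at_top[OF tendsto_const] filterlim_real_sequentially) auto
  have E4: "\<forall>\<^sub>F m in sequentially. d / 8 * real m > 1"
    using d by (intro filterlim_at_top_dense[THEN iffD1, rule_format] filterlim_tendsto_pos_mult_at_top[OF tendsto_const] filterlim_real_sequentially) auto
  show ?thesis using E1 E2 E3 E4 eventually_ge_at_top[of 2]
  proof eventually_elim
    case (elim m)
    have lm: "ln (real m) > 0" using elim by simp
    have large: "\<bar>real (prime_pi v) * ln (real m) - real v\<bar> \<le> 3 / 4 * d * real m"
      if v: "v \<le> 2 * m" "real v \<ge> d / 8 * real m" for v
    proof -
      define r where "r = ln (real m) / ln (real v)"
      have v2: "real v > 2" "v \<ge> V" using elim v by auto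
      have lv: "ln (real v) > 0" using v2 by simp
      have dm: "d / 8 * real m > 1" using elim by simp
      have "real v \<le> 2 * real m" using v by simp
      have "ln (real v) \<le> ln (2 * real m)" using v v2 by simp
      hence "ln (real m) / ln (2 * real m) \<le> r"
        unfolding r_def using lm lv by (intro divide_left_mono mult_pos_pos) auto
      moreover have "ln (d / 8 * real m) \<le> ln (real v)" using v dm v2 by (subst ln_le_cancel_iff) auto
      hence "r \<le> ln (real m) / ln (d / 8 * real m)"
        unfolding r_def using lm lv ln_gt_zero[OF dm] by (intro divide_left_mono mult_pos_pos) auto
      ultimately have r: "\<bar>r - 1\<bar> \<le> d / 8" using elim(1,2) unfolding abs_le_iff by linarith
      define x where "x = real (prime_pi v) * ln (real v)"
      have "\<bar>x / real v - 1\<bar> < d / 8" using V[OF v2(2)] by (simp add: dist_real_def x_def)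
      hence "\<bar>x / real v - 1\<bar> * real v \<le> d / 8 * real v" by (intro mult_right_mono) auto
      also have "\<bar>x / real v - 1\<bar> * real v = \<bar>(x / real v - 1) * real v\<bar>" by (simp add: abs_mult)
      also have "(x / real v - 1) * real v = x - real v" using v2 by (simp add: field_simps)
      finally have x: "\<bar>x - real v\<bar> \<le> d / 8 * real v" .
      have "real (prime_pi v) * ln (real m) - real v = (x - real v) * r + real v * (r - 1)"
        using lv by (simp add: x_def r_def field_simps)
      hence "\<bar>real (prime_pi v) * ln (real m) - real v\<bar> \<le> \<bar>x - real v\<bar> * \<bar>r\<bar> + real v * \<bar>r - 1\<bar>"
        by (metis abs_triangle_ineq abs_mult abs_of_nat)
      also have "\<bar>x - real v\<bar> * \<bar>r\<bar> + real v * \<bar>r - 1\<bar> \<le> (d / 8 * real v) * 2 + real v * (d / 8)"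
      proof -
        have "\<bar>r\<bar> \<le> 2" using r d by linarith
        thus ?thesis using d by (intro add_mono mult_mono x r) auto
      qed
      also have "\<dots> = 3 / 8 * d * real v" by simp
      also have "\<dots> \<le> 3 / 8 * d * (2 * real m)" using v d by (intro mult_left_mono) auto
      finally show ?thesis by simp
    qed
    show ?case
    proof (intro allI impI)
      fix v assume v: "v \<le> 2 * m"
      have "\<bar>real (prime_pi v) * ln (real m) - real v\<bar> \<le> d * real m"
      proof (cases "real v \<ge> d / 8 * real m")
        case True
        have "3 / 4 * d * real m \<le> d * real m" using d by (simp add: mult_right_mono)
        thus ?thesis using large[OF v True] by linarith
      next
        case False
        \<comment> \<open>The least integer to which \<open>large\<close> applies. Its bound is
          \<open>3/4 * d * m\<close> plus \<open>d/8 * m\<close> plus 1 for rounding, at most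
          \<open>d * m\<close> since \<open>1 < d/8 * m\<close>.\<close>
        define w where "w = nat \<lceil>d / 8 * real m\<rceil>"
        have w1: "real w \<ge> d / 8 * real m" "real w \<le> d / 8 * real m + 1"
        proof -
          have "d / 8 * real m \<ge> 0" using d by simp
          thus "real w \<ge> d / 8 * real m" "real w \<le> d / 8 * real m + 1" unfolding w_def by linarith+
        qed
        have "d / 8 * real m \<le> 1 * real m" using d by (intro mult_right_mono) auto
        hence "w \<le> 2 * m" using w1(2) elim by linarith
        from large[OF this w1(1)] have "real (prime_pi w) * ln (real m) \<le> 3 / 4 * d * real m + real w" by linarith
        moreover have "real (prime_pi v) * ln (real m) \<le> real (prime_pi w) * ln (real m)"
          using False w1 lm by (intro mult_right_mono of_nat_mono prime_pi_mono) auto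
        moreover have "1 < d / 8 * real m" by (rule elim)
        ultimately have "real (prime_pi v) * ln (real m) \<le> d * real m" using w1 by linarith
        moreover have "real v \<le> d * real m" using False d by (auto intro: order.trans)
        moreover have "real (prime_pi v) * ln (real m) \<ge> 0" using lm by simp
        ultimately show ?thesis by linarith
      qed
      also have "\<dots> \<le> e * real m" using d by (intro mult_right_mono) auto
      finally show "\<bar>real (prime_pi v) * ln (real m) - real v\<bar> \<le> e * real m" .
    qed
  qed
qed

section \<open>Counting pairwise coprime sets\<close>

lemma composite_has_small_prime_factor:
  fixes a :: nat
  assumes "a > 1" "\<not> prime a"
  obtains q where "prime q" "q dvd a" "q * q \<le> a"
proof -
  obtain b c where bc: "a = b * c" "1 < b" "1 < c"
    using assms by (metis Suc_lessI dvd_def dvd_triv_left mult.right_neutral mult_eq_0_iff nat_neq_iff not_gr_zero not_less_zero One_nat_def prime_nat_iff)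
  define d where "d = min b c"
  have "d \<noteq> 1" using bc by (auto simp: d_def)
  then obtain q where q: "prime q" "q dvd d" using prime_factor_nat by blast
  have "d > 0" using bc by (auto simp: d_def)
  hence "q \<le> d" using q by (auto dest: dvd_imp_le)
  hence "q * q \<le> b * c" by (intro mult_mono) (auto simp: d_def)
  moreover have "q dvd a" using q bc by (auto simp: d_def min_def split: if_splits)
  ultimately show ?thesis using that q bc by blast
qed

definition pairwise_coprime_sets :: "nat \<Rightarrow> nat set set" where
  "pairwise_coprime_sets n = {S. S \<subseteq> {1..n} \<and> (\<forall>a\<in>S. \<forall>b\<in>S. a \<noteq> b \<longrightarrow> coprime a b)}"

lemma finite_pairwise_coprime_sets: "finite (pairwise_coprime_sets n)"
  by (rule finite_subset[of _ "Pow {1..n}"]) (auto simp: pairwise_coprime_sets_def)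

section \<open>Upper bound: encoding a set by its multiples of small primes\<close>

lemma card_multiples_le:
  assumes "q > (0::nat)"
  shows "card {a\<in>{1..n}. q dvd a} \<le> n div q"
proof -
  have "{a\<in>{1..n}. q dvd a} \<subseteq> (\<lambda>j. q * j) ` {1..n div q}"
    using assms by (auto simp: dvd_def image_iff less_eq_div_iff_mult_less_eq mult_ac Suc_le_eq)
  hence "card {a\<in>{1..n}. q dvd a} \<le> card {1..n div q}" by (intro surj_card_le) auto
  thus ?thesis by simp
qed

text \<open>A set is determined by its intersection with 1 and the primes, together with the map
  sending each prime \<open>q\<close> with \<open>q * q \<le> n\<close> to its unique multiple in
  the set, if any. There are at most \<open>1 + n div q\<close> values at \<open>q\<close>.\<close>

lemma coprime_subset_count_upper:
  "coprime_subset_count n \<le> 2 ^ (prime_pi n + 1) * (\<Prod>q | prime q \<and> q * q \<le> n. 1 + n div q)"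
proof -
  define Q where "Q = {q. prime q \<and> q * q \<le> n}"
  define B where "B = insert 1 {p. prime p \<and> p \<le> n}"
  define M where "M = (\<lambda>q. insert 0 {a\<in>{1..n}. q dvd a})"
  \<comment> \<open>The sum runs over at most one element, so it returns that element, or 0 if there
    is none; 0 lies outside \<open>{1..n}\<close> and thus marks absence unambiguously.\<close>
  define F where "F = (\<lambda>S. restrict (\<lambda>q. \<Sum>{a\<in>S. q dvd a}) Q)"
  have finQ: "finite Q"
  proof (rule finite_subset[of _ "{..n}"])
    show "Q \<subseteq> {..n}"
    proof
      fix q assume "q \<in> Q"
      hence "q * q \<le> n" by (simp add: Q_def)
      thus "q \<in> {..n}" using order.trans[OF le_square[of q]] by simp
    qed
  qed simp
  have finP: "finite {p. prime p \<and> p \<le> n}" by (rule finite_subset[of _ "{..n}"]) auto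
  have finB: "finite B" using finP by (simp add: B_def)
  have multiple: "{a\<in>S. q dvd a} = {} \<or> (\<exists>a. {a\<in>S. q dvd a} = {a})"
    if S: "S \<in> pairwise_coprime_sets n" and q: "prime q" for S q
  proof -
    have "a = b" if "a \<in> S" "b \<in> S" "q dvd a" "q dvd b" for a b
    proof (rule ccontr)
      assume "a \<noteq> b"
      hence "coprime a b" using S that by (auto simp: pairwise_coprime_sets_def)
      hence "q = 1" using that coprime_common_divisor_nat by blast
      thus False using q by simp
    qed
    thus ?thesis by blast
  qed
  have F_cases: "F S q = 0 \<or> (F S q \<in> S \<and> q dvd F S q)"
    if S: "S \<in> pairwise_coprime_sets n" and q: "q \<in> Q" for S q
  proof -
    have "prime q" using q by (simp add: Q_def)
    from multiple[OF S this] consider "{a\<in>S. q dvd a} = {}" | a where "{a\<in>S. q dvd a} = {a}" by blast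
    thus ?thesis
    proof cases
      case 1
      thus ?thesis using q by (simp add: F_def del: Collect_empty_eq)
    next
      case (2 a)
      hence "F S q = a" using q by (simp add: F_def)
      thus ?thesis using 2 by blast
    qed
  qed
  have recover: "S = (S \<inter> B) \<union> (F S ` Q - {0})" if S: "S \<in> pairwise_coprime_sets n" for S
  proof
    show "(S \<inter> B) \<union> (F S ` Q - {0}) \<subseteq> S" using F_cases[OF S] by auto
    show "S \<subseteq> (S \<inter> B) \<union> (F S ` Q - {0})"
    proof
      fix a assume a: "a \<in> S"
      hence an: "1 \<le> a" "a \<le> n" using S by (auto simp: pairwise_coprime_sets_def)
      show "a \<in> (S \<inter> B) \<union> (F S ` Q - {0})"
      proof (cases "a \<in> B")
        case False
        hence "a > 1" "\<not> prime a" using an by (auto simp: B_def)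
        then obtain q where q: "prime q" "q dvd a" "q * q \<le> a" by (rule composite_has_small_prime_factor)
        have qQ: "q \<in> Q" using q(1) order.trans[OF q(3) an(2)] by (simp add: Q_def)
        have "a \<in> {x\<in>S. q dvd x}" using a q(2) by simp
        hence "{x\<in>S. q dvd x} = {a}" using multiple[OF S q(1)] by (metis empty_iff singletonD)
        hence "F S q = a" using qQ by (simp add: F_def)
        thus ?thesis using qQ an by (auto intro!: image_eqI[of _ _ q])
      qed (use a in auto)
    qed
  qed
  have "inj_on (\<lambda>S. (S \<inter> B, F S)) (pairwise_coprime_sets n)"
  proof (rule inj_onI)
    fix S T assume ST: "S \<in> pairwise_coprime_sets n" "T \<in> pairwise_coprime_sets n"
      and eq: "(S \<inter> B, F S) = (T \<inter> B, F T)"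
    have "S = (S \<inter> B) \<union> (F S ` Q - {0})" by (rule recover[OF ST(1)])
    also have "\<dots> = (T \<inter> B) \<union> (F T ` Q - {0})" using eq by simp
    also have "\<dots> = T" by (rule recover[OF ST(2), symmetric])
    finally show "S = T" .
  qed
  moreover have "(\<lambda>S. (S \<inter> B, F S)) ` pairwise_coprime_sets n \<subseteq> Pow B \<times> PiE Q M"
  proof (rule image_subsetI)
    fix S assume S: "S \<in> pairwise_coprime_sets n"
    have "F S q \<in> M q" if "q \<in> Q" for q
      using F_cases[OF S that] S by (auto simp: M_def pairwise_coprime_sets_def)
    hence "F S \<in> PiE Q M" by (auto simp: F_def)
    thus "(S \<inter> B, F S) \<in> Pow B \<times> PiE Q M" by auto
  qed
  moreover have "finite (Pow B \<times> PiE Q M)" using finB finQ by (auto intro!: finite_PiE simp: M_def)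
  ultimately have "card (pairwise_coprime_sets n) \<le> card (Pow B \<times> PiE Q M)"
    by (rule card_inj_on_le)
  also have "\<dots> = 2 ^ card B * (\<Prod>q\<in>Q. card (M q))"
    using finB finQ by (simp add: card_cartesian_product card_Pow card_PiE)
  also have "\<dots> \<le> 2 ^ (prime_pi n + 1) * (\<Prod>q\<in>Q. 1 + n div q)"
  proof (intro mult_mono prod_mono power_increasing)
    show "card B \<le> prime_pi n + 1" unfolding B_def prime_pi_def using finP by (simp add: card_insert_if)
    fix q assume "q \<in> Q"
    hence "q > 0" by (simp add: Q_def prime_gt_0_nat)
    have "card (M q) = Suc (card {a\<in>{1..n}. q dvd a})" unfolding M_def by (subst card_insert_disjoint) auto
    thus "0 \<le> card (M q) \<and> card (M q) \<le> 1 + n div q" using card_multiples_le[OF \<open>q > 0\<close>, of n] by simp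
  qed auto
  finally show ?thesis by (simp add: coprime_subset_count_def pairwise_coprime_sets_def Q_def)
qed

section \<open>Lower bound: matching small primes with large ones\<close>

text \<open>The values are chosen for decreasing \<open>q\<close>.\<close>

lemma card_injective_choices_ge:
  fixes Q :: "nat set" and A :: "nat \<Rightarrow> 'a set"
  assumes "finite Q" "\<And>q. q \<in> Q \<Longrightarrow> finite (A q)"
    and "\<And>q. q \<in> Q \<Longrightarrow> K + card {r\<in>Q. q < r} \<le> card (A q)"
  shows "K ^ card Q \<le> card {f \<in> PiE Q A. inj_on f Q}"
  using assms
proof (induction Q rule: finite_linorder_min_induct)
  case empty
  thus ?case by simp
next
  case (insert b Q)
  define E where "E = {f \<in> PiE Q A. inj_on f Q}"
  define E' where "E' = {f \<in> PiE (insert b Q) A. inj_on f (insert b Q)}"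
  have bQ: "b \<notin> Q" using insert.hyps by auto
  have "{r \<in> insert b Q. q < r} = {r \<in> Q. q < r}" if "q \<in> Q" for q
    using that insert.hyps by auto
  hence IH: "K ^ card Q \<le> card E"
    unfolding E_def using insert.prems by (intro insert.IH) (simp_all, metis)
  have finE: "finite E" "finite E'"
    unfolding E_def E'_def using insert.hyps insert.prems(1)
    by (auto intro!: finite_PiE finite_subset[OF Collect_restrict] simp del: inj_on_insert)
  \<comment> \<open>The induction inserts a new minimum \<open>b\<close>, so the elements above
    \<open>b\<close> are exactly those already assigned. They block at most \<open>card Q\<close>
    values, leaving \<open>K\<close>.\<close>
  have "{r \<in> insert b Q. b < r} = Q" using insert.hyps by auto
  hence Ab: "K + card Q \<le> card (A b)" "finite (A b)" using insert.prems(2)[of b] insert.prems(1) by auto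
  have "K ^ card (insert b Q) = K ^ card Q * K" using insert.hyps bQ by simp
  also have "\<dots> \<le> card E * K" using IH by (rule mult_right_mono) simp
  also have "\<dots> \<le> (\<Sum>f\<in>E. card (A b - f ` Q))"
  proof (rule sum_bounded_below[where 'a = nat, simplified])
    fix f assume "f \<in> E"
    have "card (f ` Q) \<le> card Q" using insert.hyps by (intro card_image_le) auto
    moreover have "card (A b) - card (f ` Q) \<le> card (A b - f ` Q)"
      using insert.hyps by (intro diff_card_le_card_Diff) auto
    ultimately show "K \<le> card (A b - f ` Q)" using Ab by linarith
  qed
  also have "\<dots> = card (Sigma E (\<lambda>f. A b - f ` Q))"
    using finE Ab by (subst card_SigmaI) auto
  also have "\<dots> \<le> card E'"
  proof (rule card_inj_on_le[of "\<lambda>(f, y). f(b := y)"])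
    show "inj_on (\<lambda>(f, y). f(b := y)) (Sigma E (\<lambda>f. A b - f ` Q))"
    proof (rule inj_onI, clarify)
      fix f y g z assume fg: "f \<in> E" "g \<in> E" and eq: "f(b := y) = g(b := z)"
      have "f b = g b" using fg bQ by (auto simp: E_def PiE_def extensional_def)
      hence "f = g" using eq by (metis fun_upd_triv fun_upd_upd)
      moreover have "y = z" using fun_cong[OF eq, of b] by simp
      ultimately show "f = g \<and> y = z" by blast
    qed
    show "(\<lambda>(f, y). f(b := y)) ` Sigma E (\<lambda>f. A b - f ` Q) \<subseteq> E'"
    proof clarify
      fix f y assume f: "f \<in> E" and y: "y \<in> A b" "y \<notin> f ` Q"
      have "f(b := y) \<in> PiE (insert b Q) A" using f y by (auto simp: E_def intro!: PiE_fun_upd)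
      moreover have "inj_on (f(b := y)) (insert b Q)"
        using f y bQ by (auto simp: E_def inj_on_def)
      ultimately show "f(b := y) \<in> E'" by (simp add: E'_def)
    qed
  qed (rule finE)
  finally show ?case by (simp add: E'_def)
qed

text \<open>A matching \<open>f\<close> and a set \<open>T\<close> of unmatched primes above
  \<open>m\<close> give the coprime set of all \<open>q * f q\<close> and all elements of
  \<open>T\<close>. Primes up to \<open>m\<close> enter only through matched products, and matched
  large primes are not free, which is why the powers of 2 for \<open>prime_pi m\<close> and
  \<open>prime_pi y\<close> appear on the right.\<close>

lemma coprime_subset_count_lower:
  assumes y: "y \<le> m" and m: "m \<le> n"
    and A: "\<And>q. prime q \<Longrightarrow> q \<le> y \<Longrightarrow> A q \<subseteq> {p. prime p \<and> m < p \<and> q * p \<le> n}"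
    and K: "\<And>q. prime q \<Longrightarrow> q \<le> y \<Longrightarrow> K + card {r. prime r \<and> r \<le> y \<and> q < r} \<le> card (A q)"
  shows "K ^ prime_pi y * 2 ^ prime_pi n \<le> coprime_subset_count n * 2 ^ (prime_pi m + prime_pi y)"
proof -
  define Q where "Q = {p. prime p \<and> p \<le> y}"
  define Big where "Big = {p. prime p \<and> m < p \<and> p \<le> n}"
  define E where "E = {f \<in> PiE Q A. inj_on f Q}"
  define build where "build = (\<lambda>(f, T). T \<union> (\<lambda>q. q * f q) ` Q)"
  have finP: "finite {p::nat. prime p \<and> p \<le> k}" for k by (rule finite_subset[of _ "{..k}"]) auto
  have finQ: "finite Q" unfolding Q_def by (rule finP)
  have finBig: "finite Big" by (rule finite_subset[OF _ finP[of n]]) (auto simp: Big_def)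
  have AB: "A q \<subseteq> Big" if "q \<in> Q" for q
  proof
    fix p assume p: "p \<in> A q"
    have q: "prime q" "q \<le> y" using that by (auto simp: Q_def)
    have "prime p" "m < p" "q * p \<le> n" using A[OF q] p by auto
    moreover have "p \<le> q * p" using prime_gt_0_nat[OF q(1)] by simp
    ultimately have "p \<le> n" by (metis order.trans)
    with \<open>prime p\<close> \<open>m < p\<close> show "p \<in> Big" by (simp add: Big_def)
  qed
  have finA: "finite (A q)" if "q \<in> Q" for q by (rule finite_subset[OF AB[OF that] finBig])
  have finE: "finite E" unfolding E_def
    by (intro finite_subset[OF Collect_restrict] finite_PiE finQ finA)
  have fE: "prime (f q)" "m < f q" "q * f q \<le> n" "f q \<in> Big" if "f \<in> E" "q \<in> Q" for f q
  proof -
    have "f q \<in> A q" using that by (auto simp: E_def)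
    moreover have "prime q" "q \<le> y" using that by (auto simp: Q_def)
    ultimately show "prime (f q)" "m < f q" "q * f q \<le> n" "f q \<in> Big" using A AB[OF that(2)] by auto
  qed
  have Qm: "prime q" "q \<le> m" "q > 0" if "q \<in> Q" for q
    using that y by (auto simp: Q_def prime_gt_0_nat)
  have cE: "K ^ card Q \<le> card E"
    unfolding E_def
  proof (rule card_injective_choices_ge[OF finQ finA])
    fix q assume q: "q \<in> Q"
    have "{r \<in> Q. q < r} = {r. prime r \<and> r \<le> y \<and> q < r}" by (auto simp: Q_def)
    thus "K + card {r \<in> Q. q < r} \<le> card (A q)" using K[of q] q by (simp add: Q_def)
  qed
  have "K ^ card Q * 2 ^ (card Big - card Q) \<le> card E * 2 ^ (card Big - card Q)"
    using cE by (rule mult_right_mono) simp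
  also have "\<dots> = (\<Sum>f\<in>E. card (Pow (Big - f ` Q)))"
  proof -
    have "card (Pow (Big - f ` Q)) = 2 ^ (card Big - card Q)" if f: "f \<in> E" for f
    proof -
      have "f ` Q \<subseteq> Big" using fE(4)[OF f] by auto
      moreover have "card (f ` Q) = card Q" using f by (intro card_image) (simp add: E_def)
      ultimately show ?thesis using finBig finQ by (simp add: card_Pow card_Diff_subset)
    qed
    thus ?thesis by simp
  qed
  also have "\<dots> = card (Sigma E (\<lambda>f. Pow (Big - f ` Q)))"
    using finE finBig by (subst card_SigmaI) auto
  also have "\<dots> \<le> card (pairwise_coprime_sets n)"
  proof (rule card_inj_on_le[of build])
    have not_prime: "\<not> prime (q * f q)" if "f \<in> E" "q \<in> Q" for f q
      using Qm[OF that(2)] fE[OF that] prime_product by (metis not_prime_1)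
    \<comment> \<open>Primality separates the two components of a constructed set, so
      \<open>T\<close> and the set of products can be read off from it.\<close>
    have primes: "{x \<in> build (f, T). prime x} = T" if "f \<in> E" "T \<subseteq> Big - f ` Q" for f T
      using that not_prime[OF that(1)] by (auto simp: build_def Big_def)
    have composites: "{x \<in> build (f, T). \<not> prime x} = (\<lambda>q. q * f q) ` Q" if "f \<in> E" "T \<subseteq> Big - f ` Q" for f T
      using that not_prime[OF that(1)] by (auto simp: build_def Big_def)
    show "inj_on build (Sigma E (\<lambda>f. Pow (Big - f ` Q)))"
    proof (rule inj_onI, clarify)
      fix f T g U
      assume f: "f \<in> E" and T: "T \<subseteq> Big - f ` Q" and g: "g \<in> E" and U: "U \<subseteq> Big - g ` Q"
        and eq: "build (f, T) = build (g, U)"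
      have TU: "T = U" using primes[OF f T] primes[OF g U] eq by simp
      have im: "(\<lambda>q. q * f q) ` Q = (\<lambda>q. q * g q) ` Q"
        using composites[OF f T] composites[OF g U] eq by simp
      \<comment> \<open>Since \<open>q \<le> m < g r\<close>, the prime \<open>q\<close> can divide
        \<open>r * g r\<close> only by being \<open>r\<close>; hence each product reveals which
        \<open>q\<close> it belongs to.\<close>
      have "f q = g q" if q: "q \<in> Q" for q
      proof -
        have "q * f q \<in> (\<lambda>q. q * g q) ` Q" using im q by blast
        then obtain r where r: "r \<in> Q" "q * f q = r * g r" by auto
        have "q dvd r * g r" using r(2) by (metis dvd_triv_left)
        hence "q dvd r \<or> q dvd g r" using Qm(1)[OF q] prime_dvd_mult_iff by blast
        hence "q = r \<or> q = g r" using Qm(1)[OF q] Qm(1)[OF r(1)] fE(1)[OF g r(1)] primes_dvd_imp_eq by blast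
        moreover have "q \<noteq> g r" using Qm(2)[OF q] fE(2)[OF g r(1)] by simp
        ultimately have "q = r" by blast
        thus ?thesis using r(2) Qm(3)[OF q] by simp
      qed
      moreover have "f \<in> extensional Q" "g \<in> extensional Q" using f g by (auto simp: E_def PiE_def)
      ultimately have "f = g" by (intro extensionalityI) auto
      thus "f = g \<and> T = U" using TU by blast
    qed
    show "build ` Sigma E (\<lambda>f. Pow (Big - f ` Q)) \<subseteq> pairwise_coprime_sets n"
    proof clarify
      fix f T assume f: "f \<in> E" and T: "T \<subseteq> Big - f ` Q"
      have TT: "prime p" "m < p" "p \<le> n" "p \<notin> f ` Q" if "p \<in> T" for p
        using T that by (auto simp: Big_def)
      have "1 \<le> q * f q" if "q \<in> Q" for q
        using Qm[OF that] fE(1)[OF f that] by (simp add: Suc_le_eq prime_gt_0_nat)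
      moreover have "1 \<le> p" if "p \<in> T" for p using TT(1)[OF that] by (rule prime_ge_1_nat)
      ultimately have "build (f, T) \<subseteq> {1..n}"
        using TT(3) fE(3)[OF f] by (auto simp: build_def)
      moreover have "coprime a b" if ab: "a \<in> build (f, T)" "b \<in> build (f, T)" "a \<noteq> b" for a b
      proof -
        have c1: "coprime p (q * f q)" if "p \<in> T" "q \<in> Q" for p q
        proof -
          have "p \<noteq> q" using TT(2)[OF that(1)] Qm(2)[OF that(2)] by simp
          moreover have "p \<noteq> f q" using TT(4)[OF that(1)] that(2) by auto
          ultimately show ?thesis
            using TT(1)[OF that(1)] Qm(1)[OF that(2)] fE(1)[OF f that(2)]
            by (simp add: primes_coprime)
        qed
        have c2: "coprime (q * f q) (r * f r)" if "q \<in> Q" "r \<in> Q" "q \<noteq> r" for q r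
        proof -
          have "f q \<noteq> f r" using f that by (auto simp: E_def inj_on_def)
          moreover have "q \<noteq> f r" "f q \<noteq> r" using Qm(2) fE(2)[OF f] that by (metis not_le)+
          ultimately show ?thesis
            using Qm(1) fE(1)[OF f] that by (simp add: primes_coprime)
        qed
        have c3: "coprime p p'" if "p \<in> T" "p' \<in> T" "p \<noteq> p'" for p p'
          using TT(1) that by (simp add: primes_coprime)
        have "a \<in> T \<or> (\<exists>q\<in>Q. a = q * f q)" "b \<in> T \<or> (\<exists>q\<in>Q. b = q * f q)"
          using ab by (auto simp: build_def)
        thus ?thesis using ab(3) by (metis c1 c2 c3 coprime_commute)
      qed
      ultimately show "build (f, T) \<in> pairwise_coprime_sets n" by (auto simp: pairwise_coprime_sets_def)
    qed
  qed (rule finite_pairwise_coprime_sets)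
  finally have main: "K ^ card Q * 2 ^ (card Big - card Q) \<le> coprime_subset_count n"
    by (simp add: coprime_subset_count_def pairwise_coprime_sets_def)
  have Qpi: "card Q = prime_pi y" by (simp add: Q_def prime_pi_def)
  have "prime_pi n = prime_pi m + card Big"
  proof -
    have "{p. prime p \<and> p \<le> n} = {p. prime p \<and> p \<le> m} \<union> Big" using m by (auto simp: Big_def)
    thus ?thesis unfolding prime_pi_def using finP finBig
      by (simp only:) (rule card_Un_disjoint, auto simp: Big_def)
  qed
  \<comment> \<open>Even with truncated subtraction, \<open>card Big\<close> is at most
    \<open>(card Big - card Q) + card Q\<close>, which is all that the comparison of exponents
    uses.\<close>
  hence "K ^ prime_pi y * 2 ^ prime_pi n \<le> K ^ card Q * 2 ^ ((card Big - card Q) + (prime_pi m + prime_pi y))"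
    unfolding Qpi by (intro mult_left_mono power_increasing) auto
  also have "\<dots> = (K ^ card Q * 2 ^ (card Big - card Q)) * 2 ^ (prime_pi m + prime_pi y)"
    by (simp add: power_add)
  also have "\<dots> \<le> coprime_subset_count n * 2 ^ (prime_pi m + prime_pi y)"
    by (intro mult_right_mono main) simp
  finally show ?thesis .
qed

section \<open>Asymptotics\<close>

definition isqrt :: "nat \<Rightarrow> nat" where
  "isqrt n = nat \<lfloor>sqrt (real n)\<rfloor>"

lemma isqrt_le: "real (isqrt n) \<le> sqrt (real n)" and less_isqrt: "sqrt (real n) < real (isqrt n) + 1"
proof -
  have "sqrt (real n) \<ge> 0" by simp
  thus "real (isqrt n) \<le> sqrt (real n)" "sqrt (real n) < real (isqrt n) + 1"
    unfolding isqrt_def by linarith+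
qed

lemma le_isqrt_iff: "q \<le> isqrt n \<longleftrightarrow> q * q \<le> n"
proof -
  have "q \<le> isqrt n \<longleftrightarrow> real q \<le> sqrt (real n)"
    using isqrt_le[of n] less_isqrt[of n] by linarith
  also have "\<dots> \<longleftrightarrow> (real q)\<^sup>2 \<le> real n"
    by (metis of_nat_0_le_iff real_le_rsqrt real_sqrt_le_iff real_sqrt_pow2 real_sqrt_unique)
  also have "\<dots> \<longleftrightarrow> q * q \<le> n"
    unfolding power2_eq_square of_nat_mult[symmetric] of_nat_le_iff ..
  finally show ?thesis .
qed

lemma le_Suc_isqrt_square: "real n \<le> (real (isqrt n) + 1)\<^sup>2"
proof -
  have "real n = (sqrt (real n))\<^sup>2" by simp
  also have "\<dots> \<le> (real (isqrt n) + 1)\<^sup>2" using less_isqrt[of n] by (intro power_mono) auto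
  finally show ?thesis .
qed

lemma filterlim_isqrt: "filterlim isqrt at_top sequentially"
  unfolding filterlim_at_top
proof
  fix k
  show "\<forall>\<^sub>F n in sequentially. k \<le> isqrt n"
    using eventually_ge_at_top[of "k * k"] by eventually_elim (simp add: le_isqrt_iff)
qed

lemma coprime_subset_count_pos: "coprime_subset_count n > 0"
proof -
  have "{} \<in> pairwise_coprime_sets n" by (simp add: pairwise_coprime_sets_def)
  hence "card (pairwise_coprime_sets n) > 0"
    using finite_pairwise_coprime_sets[of n] by (auto simp: card_gt_0_iff)
  thus ?thesis by (simp add: coprime_subset_count_def pairwise_coprime_sets_def)
qed

definition log_excess :: "nat \<Rightarrow> real" where
  "log_excess n = ln (real (coprime_subset_count n)) - real (prime_pi n) * ln 2"

text \<open>Each factor \<open>1 + n div q\<close> is at most \<open>2 * (m + 1)^2 / q\<close>.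
  Apart from \<open>ln 2\<close> per prime this produces twice
  \<open>prime_pi m * ln (m + 1)\<close> minus \<open>theta m\<close>, an expression in
  \<open>m\<close> alone.\<close>

lemma log_excess_upper:
  fixes n :: nat
  defines "m \<equiv> isqrt n"
  shows "log_excess n \<le> ln 2 + real (prime_pi m) * (ln 2 + 2 * ln (real m + 1)) - theta m"
proof -
  define Q where "Q = {q. prime q \<and> q \<le> m}"
  have Q: "{q. prime q \<and> q * q \<le> n} = Q" by (simp add: Q_def m_def le_isqrt_iff)
  have finQ: "finite Q" by (simp add: Q_def)
  have term_le: "ln (real (1 + n div q)) \<le> (ln 2 + 2 * ln (real m + 1)) - ln (real q)" if "q \<in> Q" for q
  proof -
    have q: "q > 0" "q * q \<le> n" using that by (auto simp: Q_def m_def le_isqrt_iff prime_gt_0_nat)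
    have "q \<le> n" using order.trans[OF le_square[of q] q(2)] .
    have "real (1 + n div q) \<le> 1 + real n / real q" using of_nat_div_le_of_nat[of n q, where 'a = real] by simp
    also have "\<dots> \<le> 2 * real n / real q" using q \<open>q \<le> n\<close> by (simp add: field_simps)
    also have "\<dots> \<le> 2 * (real m + 1)\<^sup>2 / real q"
      using le_Suc_isqrt_square[of n] unfolding m_def by (intro divide_right_mono mult_left_mono) auto
    finally have "ln (real (1 + n div q)) \<le> ln (2 * (real m + 1)\<^sup>2 / real q)"
      using q by (subst ln_le_cancel_iff) (auto intro!: divide_pos_pos)
    also have "\<dots> = (ln 2 + 2 * ln (real m + 1)) - ln (real q)"
    proof -
      have "ln ((real m + 1)\<^sup>2) = 2 * ln (real m + 1)" by (simp add: ln_realpow)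
      moreover have "(real m + 1)\<^sup>2 > 0" by simp
      ultimately show ?thesis using q by (simp add: ln_div ln_mult)
    qed
    finally show ?thesis .
  qed
  have "real (coprime_subset_count n) \<le> real (2 ^ (prime_pi n + 1) * (\<Prod>q\<in>Q. 1 + n div q))"
    using coprime_subset_count_upper[of n] unfolding Q of_nat_le_iff .
  hence "ln (real (coprime_subset_count n)) \<le> ln (real (2 ^ (prime_pi n + 1) * (\<Prod>q\<in>Q. 1 + n div q)))"
    using coprime_subset_count_pos[of n] by (subst ln_le_cancel_iff) (auto simp: finQ intro!: mult_pos_pos prod_pos)
  also have "\<dots> = ln (2 ^ (prime_pi n + 1)) + ln (\<Prod>q\<in>Q. real (1 + n div q))"
    unfolding of_nat_mult of_nat_prod of_nat_power of_nat_numeral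
    by (rule ln_mult_pos) (auto intro!: prod_pos)
  also have "ln (2 ^ (prime_pi n + 1)) = real (prime_pi n + 1) * ln 2" by (rule ln_realpow)
  also have "ln (\<Prod>q\<in>Q. real (1 + n div q)) = (\<Sum>q\<in>Q. ln (real (1 + n div q)))"
    by (rule ln_prod) (auto simp: finQ)
  also have "\<dots> \<le> (\<Sum>q\<in>Q. (ln 2 + 2 * ln (real m + 1)) - ln (real q))"
    by (rule sum_mono) (rule term_le)
  also have "\<dots> = real (prime_pi m) * (ln 2 + 2 * ln (real m + 1)) - theta m"
    by (simp add: sum_subtractf theta_def Q_def prime_pi_def)
  finally show ?thesis by (simp add: log_excess_def algebra_simps)
qed

lemma prime_pi_diff_eq:
  assumes "a \<le> b"
  shows "real (card {p. prime p \<and> a < p \<and> p \<le> b}) = real (prime_pi b) - real (prime_pi a)"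
proof -
  have "{p. prime p \<and> p \<le> b} = {p. prime p \<and> p \<le> a} \<union> {p. prime p \<and> a < p \<and> p \<le> b}"
    using assms by auto
  moreover have "finite {p. prime p \<and> a < p \<and> p \<le> b}"
    by (rule finite_subset[OF _ finite_primes_le[of b]]) auto
  ultimately have "prime_pi b = prime_pi a + card {p. prime p \<and> a < p \<and> p \<le> b}"
    unfolding prime_pi_def by (simp only:) (rule card_Un_disjoint, auto)
  thus ?thesis by simp
qed

text \<open>The arithmetic-geometric mean inequality for \<open>q\<close> and \<open>n / q\<close>,
  where rounding down the quotient costs 1. The cap at \<open>2 * m\<close> keeps the interval
  within the range of \<open>prime_pi_uniform\<close>; when it is active the bound is
  immediate.\<close>

lemma min_div_plus_ge:
  assumes "m * m \<le> n" "0 < q"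
  shows "2 * real m - 1 \<le> real (min (n div q) (2 * m)) + real q"
proof (cases "n div q \<le> 2 * m")
  case True
  have "n < q * (n div q + 1)" using assms(2) dividend_less_times_div[of q n] by (simp add: algebra_simps)
  hence "m * m < q * (n div q + 1)" using assms(1) by linarith
  hence "real (m * m) < real (q * (n div q + 1))" by (simp only: of_nat_less_iff)
  define x y where "x = real q" and "y = real (n div q) + 1"
  have "real m * real m < x * y" using \<open>real (m * m) < _\<close> by (simp add: x_def y_def algebra_simps)
  have "x \<ge> 0" "y \<ge> 0" by (auto simp: x_def y_def)
  have "2 * real m \<le> x + y"
  proof (rule power2_le_imp_le)
    have "(2 * real m)\<^sup>2 \<le> 4 * (x * y)" using \<open>real m * real m < x * y\<close> by (simp add: power2_eq_square)
    also have "\<dots> \<le> (x + y)\<^sup>2" using zero_le_power2[of "x - y"] by (simp add: power2_eq_square algebra_simps)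
    finally show "(2 * real m)\<^sup>2 \<le> (x + y)\<^sup>2" .
  qed (use \<open>x \<ge> 0\<close> \<open>y \<ge> 0\<close> in auto)
  thus ?thesis using True by (simp add: x_def y_def min_def)
qed simp

text \<open>Choices for \<open>q\<close> number about \<open>(w - m) / ln m\<close>, with
  \<open>w\<close> the capped \<open>n div q\<close>, and larger primes block about
  \<open>(d * m - q) / ln m\<close> of them. As \<open>w + q\<close> is at least about
  \<open>2 * m\<close>, some \<open>(1 - d) * m / ln m\<close> choices survive; half of this is
  claimed as \<open>K\<close>.\<close>

lemma log_excess_lower:
  assumes d: "0 < d" "d < 1"
  shows "\<forall>\<^sub>F m in sequentially. \<forall>n. isqrt n = m \<longrightarrow>
     log_excess n \<ge> real (prime_pi (nat \<lfloor>d * real m\<rfloor>)) * ln ((1 - d) / 2 * real m / ln (real m) - 1) -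
       (real (prime_pi m) + real (prime_pi (nat \<lfloor>d * real m\<rfloor>))) * ln 2"
proof -
  \<comment> \<open>The slack \<open>(1 - d) * m\<close> is shared out: half for
    \<open>K * ln m\<close>, a quarter for the four errors \<open>e * m\<close>, and a quarter for
    the 1 lost to rounding.\<close>
  define c where "c = (1 - d) / 2"
  define e where "e = (1 - d) / 16"
  have ce: "c > 0" "e > 0" using d by (auto simp: c_def e_def)
  have E1: "\<forall>\<^sub>F m in sequentially. \<forall>v\<le>2*m. \<bar>real (prime_pi v) * ln (real m) - real v\<bar> \<le> e * real m"
    by (rule prime_pi_uniform[OF ce(2)])
  have E2: "\<forall>\<^sub>F m in sequentially. c * real m / ln (real m) - 1 > 1"
    using ce(1) by real_asymp
  have E3: "\<forall>\<^sub>F m in sequentially. (1 - d) / 4 * real m > 1"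
    using d by real_asymp
  show ?thesis using E1 E2 E3 eventually_ge_at_top[of 2]
  proof (eventually_elim, intro allI impI)
    fix m n :: nat
    assume pi: "\<forall>v\<le>2*m. \<bar>real (prime_pi v) * ln (real m) - real v\<bar> \<le> e * real m"
      and k: "c * real m / ln (real m) - 1 > 1" and dm: "(1 - d) / 4 * real m > 1" and m2: "m \<ge> 2"
      and mn: "isqrt n = m"
    define y where "y = nat \<lfloor>d * real m\<rfloor>"
    define K where "K = nat \<lfloor>c * real m / ln (real m)\<rfloor>"
    define A where "A = (\<lambda>q. {p. prime p \<and> m < p \<and> p \<le> min (n div q) (2 * m)})"
    have lm: "ln (real m) > 0" using m2 by simp
    have K: "real K \<le> c * real m / ln (real m)" "real K \<ge> c * real m / ln (real m) - 1"
      using k unfolding K_def by linarith+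
    have dm0: "d * real m \<ge> 0" using d by simp
    hence y: "real y \<le> d * real m" unfolding y_def by linarith
    also have "\<dots> \<le> real m" using d by (simp add: mult_left_le_one_le)
    finally have ym: "y \<le> m" by simp
    have mmn: "m * m \<le> n" using le_isqrt_iff[of m n] mn by simp
    hence m_le_n: "m \<le> n" using le_square[of m] by linarith
    have "K ^ prime_pi y * 2 ^ prime_pi n \<le> coprime_subset_count n * 2 ^ (prime_pi m + prime_pi y)"
    proof (rule coprime_subset_count_lower[OF ym m_le_n])
      fix q assume q: "prime q" "q \<le> y"
      have q0: "q > 0" using q by (simp add: prime_gt_0_nat)
      show "A q \<subseteq> {p. prime p \<and> m < p \<and> q * p \<le> n}"
        using q0 by (auto simp: A_def less_eq_div_iff_mult_less_eq mult.commute)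
      define w where "w = min (n div q) (2 * m)"
      have "m * q \<le> n" using mult_le_mono2[of q m m] q ym mmn by linarith
      hence "m \<le> n div q" using q0 by (simp add: less_eq_div_iff_mult_less_eq)
      hence w: "m \<le> w" "w \<le> 2 * m" by (auto simp: w_def)
      have cardA: "real (card (A q)) = real (prime_pi w) - real (prime_pi m)"
        unfolding A_def w_def[symmetric] by (rule prime_pi_diff_eq[OF w(1)])
      have "{r. prime r \<and> r \<le> y \<and> q < r} = {r. prime r \<and> q < r \<and> r \<le> y}" by auto
      hence cardr: "real (card {r. prime r \<and> r \<le> y \<and> q < r}) = real (prime_pi y) - real (prime_pi q)"
        using prime_pi_diff_eq[OF q(2)] by simp
      have wq: "2 * real m - 1 \<le> real w + real q" unfolding w_def by (rule min_div_plus_ge[OF mmn q0])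
      have p: "real (prime_pi y) * ln (real m) \<le> real y + e * real m"
              "real (prime_pi q) * ln (real m) \<ge> real q - e * real m"
              "real (prime_pi w) * ln (real m) \<ge> real w - e * real m"
              "real (prime_pi m) * ln (real m) \<le> real m + e * real m"
        using pi[rule_format, of y] pi[rule_format, of q] pi[rule_format, of w] pi[rule_format, of m] ym q w
        by (auto simp: abs_le_iff)
      have "c * real m + 4 * (e * real m) + d * real m + real m + (1 - d) / 4 * real m = 2 * real m"
        by (simp add: c_def e_def field_simps)
      moreover have "real K * ln (real m) \<le> c * real m" using K(1) lm by (simp add: field_simps)
      ultimately have "real K * ln (real m) + real (prime_pi y) * ln (real m) - real (prime_pi q) * ln (real m)
         \<le> real (prime_pi w) * ln (real m) - real (prime_pi m) * ln (real m)"
        using p y wq dm by linarith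
      hence "(real K + (real (prime_pi y) - real (prime_pi q))) * ln (real m) \<le>
         (real (prime_pi w) - real (prime_pi m)) * ln (real m)" by (simp add: algebra_simps)
      hence "real K + (real (prime_pi y) - real (prime_pi q)) \<le> real (prime_pi w) - real (prime_pi m)"
        using lm by simp
      hence "real (K + card {r. prime r \<and> r \<le> y \<and> q < r}) \<le> real (card (A q))"
        unfolding cardA of_nat_add cardr .
      thus "K + card {r. prime r \<and> r \<le> y \<and> q < r} \<le> card (A q)" by (simp only: of_nat_le_iff)
    qed
    hence "real (K ^ prime_pi y * 2 ^ prime_pi n) \<le> real (coprime_subset_count n * 2 ^ (prime_pi m + prime_pi y))"
      by (simp only: of_nat_le_iff)
    moreover have K0: "real K > 0" using K(2) k by linarith
    ultimately have "ln (real K ^ prime_pi y * 2 ^ prime_pi n) \<le> ln (real (coprime_subset_count n) * 2 ^ (prime_pi m + prime_pi y))"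
      using coprime_subset_count_pos[of n] by (subst ln_le_cancel_iff) auto
    hence "real (prime_pi y) * ln (real K) + real (prime_pi n) * ln 2 \<le>
        ln (real (coprime_subset_count n)) + (real (prime_pi m) + real (prime_pi y)) * ln 2"
      using K0 coprime_subset_count_pos[of n] by (simp add: ln_mult_pos ln_realpow)
    moreover have "real (prime_pi y) * ln (c * real m / ln (real m) - 1) \<le> real (prime_pi y) * ln (real K)"
      using k K(2) K0 by (intro mult_left_mono) auto
    ultimately show "log_excess n \<ge> real (prime_pi (nat \<lfloor>d * real m\<rfloor>)) * ln ((1 - d) / 2 * real m / ln (real m) - 1) -
       (real (prime_pi m) + real (prime_pi (nat \<lfloor>d * real m\<rfloor>))) * ln 2"
      unfolding y_def[symmetric] c_def[symmetric] log_excess_def by linarith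
  qed
qed

lemma prime_pi_scaled:
  assumes d: "0 < d" "d < 1"
  shows "(\<lambda>m. real (prime_pi (nat \<lfloor>d * real m\<rfloor>)) * ln (real m) / real m) \<longlonglongrightarrow> d"
proof (rule tendstoI)
  fix e :: real assume e: "e > 0"
  have "\<forall>\<^sub>F m in sequentially. \<forall>v\<le>2*m. \<bar>real (prime_pi v) * ln (real m) - real v\<bar> \<le> e / 2 * real m"
    using e by (intro prime_pi_uniform) simp
  moreover have "\<forall>\<^sub>F m in sequentially. e / 2 * real m > 1" using e by real_asymp
  ultimately show "\<forall>\<^sub>F m in sequentially. dist (real (prime_pi (nat \<lfloor>d * real m\<rfloor>)) * ln (real m) / real m) d < e"
    using eventually_ge_at_top[of 1]
  proof eventually_elim
    case (elim m)
    define y where "y = nat \<lfloor>d * real m\<rfloor>"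
    have "d * real m \<ge> 0" using d by simp
    hence y: "real y \<le> d * real m" "d * real m < real y + 1" unfolding y_def by linarith+
    have "d * real m \<le> real m" using d by (simp add: mult_left_le_one_le)
    hence "y \<le> 2 * m" using y by linarith
    hence "\<bar>real (prime_pi y) * ln (real m) - real y\<bar> \<le> e / 2 * real m" using elim by blast
    hence "\<bar>real (prime_pi y) * ln (real m) - d * real m\<bar> < e * real m"
      using y elim(2) by linarith
    hence "\<bar>real (prime_pi y) * ln (real m) - d * real m\<bar> / real m < e"
      using elim(3) by (simp add: field_simps)
    also have "\<bar>real (prime_pi y) * ln (real m) - d * real m\<bar> / real m =
        \<bar>(real (prime_pi y) * ln (real m) - d * real m) / real m\<bar>" by simp
    also have "(real (prime_pi y) * ln (real m) - d * real m) / real m = real (prime_pi y) * ln (real m) / real m - d"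
      using elim(3) by (simp add: field_simps)
    finally show ?case by (simp add: dist_real_def y_def)
  qed
qed

text \<open>Both bounds are analysed as sequences in \<open>m\<close> and then composed with
  \<open>isqrt\<close>; \<open>sqrt n\<close> lies between \<open>m\<close> and
  \<open>m + 1\<close>, so the upper bound is compared with \<open>m\<close> and the lower one with
  \<open>m + 1\<close>.\<close>

lemma log_excess_asymptotics: "(\<lambda>n. log_excess n / sqrt (real n)) \<longlonglongrightarrow> 1"
proof (rule order_tendstoI)
  fix a :: real assume a: "a > 1"
  define X where "X = (\<lambda>m. ln 2 + real (prime_pi m) * (ln 2 + 2 * ln (real m + 1)) - theta m)"
  have "(\<lambda>m. X m / real m) \<longlonglongrightarrow> 1"
  proof -
    have "(\<lambda>m. ln 2 / real m) \<longlonglongrightarrow> 0" by real_asymp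
    moreover have "(\<lambda>m. (ln 2 + 2 * ln (real m + 1)) / ln (real m)) \<longlonglongrightarrow> 2" by real_asymp
    ultimately have "(\<lambda>m. ln 2 / real m + real (prime_pi m) * ln (real m) / real m * ((ln 2 + 2 * ln (real m + 1)) / ln (real m)) - theta m / real m)
        \<longlonglongrightarrow> 0 + 1 * 2 - 1"
      by (intro tendsto_intros prime_number_theorem theta_asymptotics)
    hence "(\<lambda>m. ln 2 / real m + real (prime_pi m) * ln (real m) / real m * ((ln 2 + 2 * ln (real m + 1)) / ln (real m)) - theta m / real m)
        \<longlonglongrightarrow> 1" by simp
    thus ?thesis
    proof (rule Lim_transform_eventually)
      show "\<forall>\<^sub>F m in sequentially. ln 2 / real m + real (prime_pi m) * ln (real m) / real m * ((ln 2 + 2 * ln (real m + 1)) / ln (real m)) - theta m / real m = X m / real m"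
        using eventually_ge_at_top[of 2]
      proof eventually_elim
        case (elim m)
        have "real (prime_pi m) * ln (real m) / real m * (t / ln (real m)) = real (prime_pi m) * t / real m" for t
          using elim by simp
        thus ?case unfolding X_def by (simp only: add_divide_distrib[symmetric] diff_divide_distrib[symmetric])
      qed
    qed
  qed
  \<comment> \<open>Positivity ensures that replacing \<open>sqrt n\<close> by the smaller
    \<open>m\<close> enlarges the quotient.\<close>
  hence "\<forall>\<^sub>F m in sequentially. X m / real m < a" "\<forall>\<^sub>F m in sequentially. X m / real m > 0"
    using a by (auto intro: order_tendstoD)
  hence "\<forall>\<^sub>F m in sequentially. X m / real m < a \<and> X m / real m > 0" by (rule eventually_conj)
  from eventually_compose_filterlim[OF this filterlim_isqrt]
  show "\<forall>\<^sub>F n in sequentially. log_excess n / sqrt (real n) < a"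
  proof eventually_elim
    case (elim n)
    define m where "m = isqrt n"
    have X: "X m / real m < a" "X m / real m > 0" using elim by (auto simp: m_def)
    hence Xm: "X m > 0" "real m > 0" by (auto simp: zero_less_divide_iff)
    have "log_excess n / sqrt (real n) \<le> X m / sqrt (real n)"
      using log_excess_upper[of n] unfolding m_def X_def by (intro divide_right_mono) auto
    also have "\<dots> \<le> X m / real m"
    proof (intro divide_left_mono mult_pos_pos)
      show "real m \<le> sqrt (real n)" unfolding m_def by (rule isqrt_le)
      thus "0 < sqrt (real n)" using Xm by linarith
    qed (use Xm in auto)
    finally show ?case using X by linarith
  qed
next
  fix a :: real assume a: "a < 1"
  \<comment> \<open>Cutting off at 0 makes the lower bound \<open>Y m\<close> positive eventually,
    so its quotient grows when \<open>m + 1\<close> is replaced by \<open>sqrt n\<close>;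
    \<open>d\<close> lies strictly between \<open>a'\<close> and 1.\<close>
  define a' where "a' = max a 0"
  define d where "d = (a' + 1) / 2"
  have a': "0 \<le> a'" "a' < 1" "a \<le> a'" using a by (auto simp: a'_def)
  have d: "0 < d" "d < 1" "a' < d" using a' by (auto simp: d_def)
  define y where "y = (\<lambda>m. nat \<lfloor>d * real m\<rfloor>)"
  define Y where "Y = (\<lambda>m. real (prime_pi (y m)) * ln ((1 - d) / 2 * real m / ln (real m) - 1) -
       (real (prime_pi m) + real (prime_pi (y m))) * ln 2)"
  have "(\<lambda>m. Y m / (real m + 1)) \<longlonglongrightarrow> d"
  proof -
    define c where "c = (1 - d) / 2"
    have c: "c > 0" using d by (simp add: c_def)
    have "(\<lambda>m. real m / (real m + 1)) \<longlonglongrightarrow> 1" by real_asymp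
    moreover have "(\<lambda>m. ln (c * real m / ln (real m) - 1) / ln (real m)) \<longlonglongrightarrow> 1" using c by real_asymp
    moreover have "(\<lambda>m. ln 2 / ln (real m)) \<longlonglongrightarrow> 0" by real_asymp
    moreover have "(\<lambda>m. real (prime_pi (y m)) * ln (real m) / real m) \<longlonglongrightarrow> d"
      unfolding y_def by (rule prime_pi_scaled[OF d(1,2)])
    ultimately have "(\<lambda>m. (real (prime_pi (y m)) * ln (real m) / real m * (ln (c * real m / ln (real m) - 1) / ln (real m)) -
       (real (prime_pi m) * ln (real m) / real m + real (prime_pi (y m)) * ln (real m) / real m) * (ln 2 / ln (real m))) *
       (real m / (real m + 1))) \<longlonglongrightarrow> (d * 1 - (1 + d) * 0) * 1"
      by (intro tendsto_intros prime_number_theorem)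
    hence "(\<lambda>m. (real (prime_pi (y m)) * ln (real m) / real m * (ln (c * real m / ln (real m) - 1) / ln (real m)) -
       (real (prime_pi m) * ln (real m) / real m + real (prime_pi (y m)) * ln (real m) / real m) * (ln 2 / ln (real m))) *
       (real m / (real m + 1))) \<longlonglongrightarrow> d" by simp
    thus ?thesis
    proof (rule Lim_transform_eventually)
      show "\<forall>\<^sub>F m in sequentially. (real (prime_pi (y m)) * ln (real m) / real m * (ln (c * real m / ln (real m) - 1) / ln (real m)) -
       (real (prime_pi m) * ln (real m) / real m + real (prime_pi (y m)) * ln (real m) / real m) * (ln 2 / ln (real m))) *
       (real m / (real m + 1)) = Y m / (real m + 1)"
        using eventually_ge_at_top[of 2]
      proof eventually_elim
        case (elim m)
        hence "real m > 0" "ln (real m) > 0" by auto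
        thus ?case unfolding Y_def c_def[symmetric] by (simp add: divide_simps) (simp add: algebra_simps)
      qed
    qed
  qed
  hence "\<forall>\<^sub>F m in sequentially. Y m / (real m + 1) > a'" using d by (intro order_tendstoD)
  moreover have "\<forall>\<^sub>F m in sequentially. \<forall>n. isqrt n = m \<longrightarrow> log_excess n \<ge> Y m"
    using log_excess_lower[OF d(1,2)] by (simp only: Y_def y_def)
  ultimately have "\<forall>\<^sub>F m in sequentially. Y m / (real m + 1) > a' \<and> (\<forall>n. isqrt n = m \<longrightarrow> log_excess n \<ge> Y m)"
    by (rule eventually_conj)
  from eventually_compose_filterlim[OF this filterlim_isqrt] eventually_ge_at_top[of 1]
  show "\<forall>\<^sub>F n in sequentially. log_excess n / sqrt (real n) > a"
  proof eventually_elim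
    case (elim n)
    define m where "m = isqrt n"
    have Y: "Y m / (real m + 1) > a'" "log_excess n \<ge> Y m" using elim(1) by (auto simp: m_def)
    have "Y m / (real m + 1) > 0" using Y(1) a' by linarith
    hence Y0: "Y m > 0" by (simp add: zero_less_divide_iff)
    have "a' < Y m / (real m + 1)" by (rule Y(1))
    also have "\<dots> \<le> Y m / sqrt (real n)"
      using Y0 less_isqrt[of n] elim(2) unfolding m_def by (intro divide_left_mono mult_pos_pos) auto
    also have "\<dots> \<le> log_excess n / sqrt (real n)" using Y(2) by (intro divide_right_mono) auto
    finally show ?case using a' by linarith
  qed
qed

theorem theorem2:
  "\<exists>\<epsilon> :: nat \<Rightarrow> real. \<epsilon> \<longlonglongrightarrow> 0 \<and>
     (\<forall>\<^sub>F n in sequentially.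
        real (coprime_subset_count n) = 2 ^ prime_pi n * exp ((1 + \<epsilon> n) * sqrt (real n)))"
proof (intro exI conjI)
  show "(\<lambda>n. log_excess n / sqrt (real n) - 1) \<longlonglongrightarrow> 0"
    using tendsto_diff[OF log_excess_asymptotics tendsto_const[of 1]] by simp
  show "\<forall>\<^sub>F n in sequentially. real (coprime_subset_count n) =
      2 ^ prime_pi n * exp ((1 + (log_excess n / sqrt (real n) - 1)) * sqrt (real n))"
    using eventually_ge_at_top[of 1]
  proof eventually_elim
    case (elim n)
    have "2 ^ prime_pi n = exp (real (prime_pi n) * ln 2)" by (simp add: exp_of_nat_mult)
    hence "2 ^ prime_pi n * exp (log_excess n) = exp (ln (real (coprime_subset_count n)))"
      by (simp add: log_excess_def flip: exp_add)
    also have "\<dots> = real (coprime_subset_count n)" using coprime_subset_count_pos[of n] by simp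
    finally show ?case using elim by simp
  qed
qed

end
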